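(* There is an absolute constant $c>0$ such that for every $h\ge 1$ and every $k\ge h$ (in particular no matter how large $k/h$ is) there exists a depth-$2$ HST on which the Double Coverage algorithm using $k$ servers is not $R$-competitive against an offline optimum with $h$ servers for any $R< c\cdot h$. That is, the competitive ratio of DC in depth-$2$ HSTs is $\Omega(h)$, even when $k/h\to\infty$.
   Context: The $(h,k)$-server problem: given a metric space, an online algorithm has $k$ servers located at points of the space; requests arrive one at a time at points of the space, and each must be served by moving some server to the requested point; the cost is the total distance moved. The algorithm is compared with an offline optimum using $h\le k$ servers. An online algorithm ALG is $R$-competitive on a metric $M$ if there is a constant $\alpha$ independent of the input such that $ALG_k(I)\le R\cdot OPT_h(I)+\alpha$ for every finite request sequence $I$ of points of $M$, where $ALG_k(I)$ is ALG's cost with $k$ servers and $OPT_h(I)$ is the optimal cost with $h$ servers. A depth-$d$ tree is an edge-weighted rooted tree in which every leaf has depth exactly $d$; requests arrive only at leaves, distances are path distances in the tree, and online servers may reside at nodes or at interior points of edges. A depth-$d$ HST is a depth-$d$ tree whose edge lengths decrease geometrically along every root-to-leaf path. Double Coverage (DC) on a tree: when a request arrives at a point $v$, all servers adjacent to $v$ move towards $v$ along the tree at the same speed until one of them reaches $v$; a server $s$ is adjacent to $v$ if no other server lies on the unique path from $s$ to $v$, and if several servers are located at the same point only one of them (chosen arbitrarily) is considered. *)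

theory Defs
  imports Complex_Main "HOL-Library.Multiset" "HOL-Library.Sublist"
begin

section \<open>Edge-weighted rooted trees\<close>

text \<open>A rooted tree is given by the addresses of its nodes: the root is the empty list and the
  parent of \<open>u @ [i]\<close> is \<open>u\<close>, so that the ancestors of a node are its prefixes.
  \<open>len T u\<close> is the length of the edge from the non-root node \<open>u\<close> to its parent.\<close>

record rtree =
  nodes :: "nat list set"
  len :: "nat list \<Rightarrow> real"

definition edge_weighted_tree :: "rtree \<Rightarrow> bool" where
  "edge_weighted_tree T \<longleftrightarrow>
     finite (nodes T) \<and> [] \<in> nodes T \<and>
     (\<forall>u i. u @ [i] \<in> nodes T \<longrightarrow> u \<in> nodes T \<and> len T (u @ [i]) > 0)"

definition leaves :: "rtree \<Rightarrow> nat list set" where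
  "leaves T = {u \<in> nodes T. \<forall>i. u @ [i] \<notin> nodes T}"

definition depth_tree :: "nat \<Rightarrow> rtree \<Rightarrow> bool" where
  "depth_tree d T \<longleftrightarrow> edge_weighted_tree T \<and> (\<forall>u\<in>leaves T. length u = d)"

text \<open>Along every root-to-leaf path, each edge is shorter than the previous one by a factor of
  at least \<open>\<sigma>\<close>.\<close>

definition depth_hst :: "real \<Rightarrow> nat \<Rightarrow> rtree \<Rightarrow> bool" where
  "depth_hst \<sigma> d T \<longleftrightarrow> depth_tree d T \<and> \<sigma> > 1 \<and>
     (\<forall>u i. u \<noteq> [] \<and> u @ [i] \<in> nodes T \<longrightarrow> \<sigma> * len T (u @ [i]) \<le> len T u)"


section \<open>The tree as a metric space\<close>

text \<open>\<open>(u, x)\<close> is the point at distance \<open>x\<close> above \<open>u\<close> on the edge from \<open>u\<close> to its parent. The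
  node \<open>u\<close> itself is \<open>(u, 0)\<close>; the strict upper bound on \<open>x\<close> makes representations unique.\<close>

type_synonym point = "nat list \<times> real"

definition points :: "rtree \<Rightarrow> point set" where
  "points T = {(u, x). u \<in> nodes T \<and> 0 \<le> x \<and> (if u = [] then x = 0 else x < len T u)}"

text \<open>The length of the part of the edge above \<open>e\<close> that lies on the path from the root to a
  point. This part always starts at the upper end of the edge, so the path between \<open>p\<close> and \<open>q\<close>,
  which is the symmetric difference of their root paths, uses a portion of length
  \<open>\<bar>covered T p e - covered T q e\<bar>\<close> of that edge.\<close>

definition covered :: "rtree \<Rightarrow> point \<Rightarrow> nat list \<Rightarrow> real" where
  "covered T p e =
     (if strict_prefix e (fst p) then len T e else if e = fst p then len T e - snd p else 0)"

definition path_dist :: "rtree \<Rightarrow> point \<Rightarrow> point \<Rightarrow> real" where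
  "path_dist T p q = (\<Sum>e\<in>nodes T - {[]}. \<bar>covered T p e - covered T q e\<bar>)"

definition path_between :: "rtree \<Rightarrow> point \<Rightarrow> point \<Rightarrow> point set" where
  "path_between T p q = {z \<in> points T. path_dist T p z + path_dist T z q = path_dist T p q}"

definition leaf_points :: "rtree \<Rightarrow> point set" where
  "leaf_points T = (\<lambda>u. (u, 0)) ` leaves T"


section \<open>Double Coverage\<close>

text \<open>A configuration of \<open>k\<close> servers is a multiset of \<open>k\<close> points. Servers at the same point are
  interchangeable, so it is immaterial which one of them is moved.\<close>

definition configs :: "rtree \<Rightarrow> nat \<Rightarrow> point multiset set" where
  "configs T k = {A. size A = k \<and> set_mset A \<subseteq> points T}"

text \<open>The positions of the servers adjacent to \<open>v\<close>; at each of them exactly one server is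
  considered.\<close>

definition adjacent :: "rtree \<Rightarrow> point \<Rightarrow> point multiset \<Rightarrow> point set" where
  "adjacent T v A = {p \<in> set_mset A. path_between T p v \<inter> set_mset A = {p}}"

definition towards :: "rtree \<Rightarrow> point \<Rightarrow> real \<Rightarrow> point \<Rightarrow> point" where
  "towards T v t p = (THE q. q \<in> path_between T p v \<and> path_dist T p q = t)"

definition advance ::
  "rtree \<Rightarrow> point \<Rightarrow> point set \<Rightarrow> real \<Rightarrow> point multiset \<Rightarrow> point multiset" where
  "advance T v S t A = A - mset_set S + image_mset (towards T v t) (mset_set S)"

text \<open>\<open>dc_serve T v A B c\<close>: serving a request at \<open>v\<close> leads from \<open>A\<close> to \<open>B\<close> at cost \<open>c\<close>. The
  motion is a sequence of stages. During a stage of duration \<open>\<delta>\<close> one server from each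
  point of \<open>S\<close> moves towards \<open>v\<close> at unit speed; before its end these are, at each time, precisely
  the adjacent servers, no two of them have met, and none has reached \<open>v\<close>. Ending a stage
  early does not change the motion, so \<open>B\<close> and \<open>c\<close> are determined by \<open>A\<close> and \<open>v\<close>.\<close>

inductive dc_serve ::
  "rtree \<Rightarrow> point \<Rightarrow> point multiset \<Rightarrow> point multiset \<Rightarrow> real \<Rightarrow> bool"
  for T :: rtree and v :: point where
  served: "v \<in># A \<Longrightarrow> dc_serve T v A A 0"
| stage: "\<lbrakk>S = adjacent T v A; \<delta> > 0;
     \<And>t. 0 \<le> t \<Longrightarrow> t < \<delta> \<Longrightarrow>
       v \<notin># advance T v S t A \<and>
       inj_on (towards T v t) S \<and>
       adjacent T v (advance T v S t A) = towards T v t ` S;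
     dc_serve T v (advance T v S \<delta> A) B c\<rbrakk>
   \<Longrightarrow> dc_serve T v A B (real (card S) * \<delta> + c)"

inductive dc_run :: "rtree \<Rightarrow> point multiset \<Rightarrow> point list \<Rightarrow> real \<Rightarrow> bool"
  for T :: rtree where
  Nil: "dc_run T A [] 0"
| Cons: "\<lbrakk>dc_serve T v A B c; dc_run T B I c'\<rbrakk> \<Longrightarrow> dc_run T A (v # I) (c + c')"


section \<open>Offline optimum and competitiveness\<close>

text \<open>\<open>X j i\<close> is the position of server \<open>i\<close> after the first \<open>j\<close> requests.\<close>

definition offline_schedule ::
  "rtree \<Rightarrow> point multiset \<Rightarrow> point list \<Rightarrow> (nat \<Rightarrow> nat \<Rightarrow> point) \<Rightarrow> bool" where
  "offline_schedule T B I X \<longleftrightarrow>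
     image_mset (X 0) (mset_set {..<size B}) = B \<and>
     (\<forall>j\<le>length I. \<forall>i<size B. X j i \<in> points T) \<and>
     (\<forall>j<length I. \<exists>i<size B. X (Suc j) i = I ! j)"

definition schedule_cost :: "rtree \<Rightarrow> nat \<Rightarrow> nat \<Rightarrow> (nat \<Rightarrow> nat \<Rightarrow> point) \<Rightarrow> real" where
  "schedule_cost T h n X = (\<Sum>j<n. \<Sum>i<h. path_dist T (X j i) (X (Suc j) i))"

definition opt_cost :: "rtree \<Rightarrow> point multiset \<Rightarrow> point list \<Rightarrow> real" where
  "opt_cost T B I =
     Inf {schedule_cost T (size B) (length I) X | X. offline_schedule T B I X}"

text \<open>Competitiveness of Double Coverage started in \<open>A\<close> against an offline optimum started in
  \<open>B\<close>; the numbers of servers are \<open>k = size A\<close> and \<open>h = size B\<close>.\<close>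

definition dc_competitive ::
  "rtree \<Rightarrow> point multiset \<Rightarrow> point multiset \<Rightarrow> real \<Rightarrow> bool" where
  "dc_competitive T A B R \<longleftrightarrow>
     (\<exists>\<alpha>. \<forall>I c. set I \<subseteq> leaf_points T \<and> dc_run T A I c \<longrightarrow> c \<le> R * opt_cost T B I + \<alpha>)"

end

theory Submission
  imports Defs "HOL-Analysis.Elementary_Metric_Spaces"
begin

text \<open>The tree has \<open>k + 1\<close> subtrees \<open>[s]\<close>, each hanging from the root by an edge of length \<open>\<sigma>\<close> and
  having \<open>h\<close> leaf edges of length 1. In each phase the adversary picks a subtree without online
  servers, moves its \<open>h\<close> servers to the leaves there, at cost at most \<open>4 h \<sigma>\<close>, and keeps requesting
  leaves of that subtree that Double Coverage has not covered. The online servers enter the subtree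
  one by one, and whenever one of them moves on the edge above \<open>[s]\<close>, all those that are already
  below it move as well. So if \<open>G\<close> is the total length of this edge covered by the root paths of the
  online servers, then \<open>G\<^sup>2\<close> grows by at most \<open>2 \<sigma>\<close> times the cost. When all leaves are covered,
  \<open>G \<ge> h \<sigma>\<close>, so the phase has cost at least \<open>h\<^sup>2 \<sigma> / 2\<close>. If the leaves are never all covered, the
  cost of the phase exceeds this bound as well.\<close>

section \<open>Double Coverage towards a point with unique geodesics\<close>

text \<open>The quadratic bound is a sum of entries: the i-th server to enter the subtree drags the
  i - 1 earlier ones along over a length \<sigma>, so h entries cost about (1 + ... + h) \<sigma>.
  G^2 is the form of this sum that also accounts for servers stopped halfway down the edge. The
  obstacle is that earlier arrivals need not all move: a server hidden behind another one on the
  same edge stands still. The invariant \<open>uncrowded\<close> excludes this. It holds in an empty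
  subtree and persists because a server about to enter an occupied stretch of the spine is blocked.
  Since Double Coverage is a relation, a lower bound on its cost also needs runs to exist. Each
  stage must therefore have a well-defined end, which comes from closedness of the set of times at
  which one moving server blocks another. The number k matters only for pigeonhole: with more
  subtrees than servers an empty one is available for every phase. Repeating phases then beats any
  additive constant.\<close>

lemma path_dist_nonneg: "0 \<le> path_dist T p q"
  by (simp add: path_dist_def sum_nonneg)

lemma path_dist_self [simp]: "path_dist T p p = 0"
  by (simp add: path_dist_def)

lemma path_dist_commute: "path_dist T p q = path_dist T q p"
  by (simp add: path_dist_def abs_minus_commute)

lemma path_dist_triangle: "path_dist T p r \<le> path_dist T p q + path_dist T q r"
  unfolding path_dist_def sum.distrib [symmetric] by (rule sum_mono) linarith

lemma path_between_trans:
  assumes "q \<in> path_between T p v" "r \<in> path_between T q v"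
  shows "r \<in> path_between T p v"
proof -
  have "path_dist T p r \<le> path_dist T p q + path_dist T q r"
       "path_dist T p v \<le> path_dist T p r + path_dist T r v"
    by (rule path_dist_triangle)+
  then show ?thesis
    using assms by (auto simp: path_between_def)
qed

section \<open>Multiset bookkeeping for one stage\<close>

lemma finite_adjacent [simp]: "finite (adjacent T v A)"
  by (simp add: adjacent_def)

text \<open>Ensures that the truncated difference in \<open>advance\<close> removes exactly what is
  added back, so no server is lost or created.\<close>

lemma mset_set_adjacent: "mset_set (adjacent T v A) \<subseteq># A"
proof -
  have "mset_set (adjacent T v A) \<subseteq># mset_set (set_mset A)"
    by (rule subset_imp_msubset_mset_set) (auto simp: adjacent_def)
  then show ?thesis
    using mset_set_set_mset_msubset subset_mset.order_trans by blast
qed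

lemma set_mset_advance_adjacent:
  "set_mset (advance T v (adjacent T v A) t A) \<subseteq> set_mset A \<union> towards T v t ` adjacent T v A"
  by (auto simp: advance_def dest: in_diffD)

lemma advance_adjacentI:
  "p \<in> adjacent T v A \<Longrightarrow> towards T v t p \<in># advance T v (adjacent T v A) t A"
  by (simp add: advance_def)

lemma size_advance_adjacent [simp]: "size (advance T v (adjacent T v A) t A) = size A"
proof -
  have "size (A - mset_set (adjacent T v A)) + size (mset_set (adjacent T v A)) = size A"
    by (metis mset_set_adjacent size_union subset_mset.diff_add)
  then show ?thesis
    by (simp only: advance_def size_union size_image_mset)
qed

text \<open>Geodesics are required only towards the one target \<open>v\<close>. This gives the
  \<open>THE\<close> in \<open>towards\<close> its meaning and is all that the general theory of the
  motion uses.\<close>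

locale geodesics_to =
  fixes T :: rtree and v :: point
  assumes target: "v \<in> points T"
    and geodesic: "\<lbrakk>p \<in> points T; 0 \<le> t; t \<le> path_dist T p v\<rbrakk>
      \<Longrightarrow> \<exists>!q. q \<in> path_between T p v \<and> path_dist T p q = t"
begin

abbreviation togo :: "point \<Rightarrow> real" where
  "togo p \<equiv> path_dist T p v"

abbreviation flow :: "real \<Rightarrow> point \<Rightarrow> point" where
  "flow \<equiv> towards T v"

lemma flow_in_path:
  assumes "p \<in> points T" "0 \<le> t" "t \<le> togo p"
  shows "flow t p \<in> path_between T p v" "path_dist T p (flow t p) = t"
  using theI' [OF geodesic [OF assms]] by (auto simp: towards_def)

lemma flow_point:
  assumes "p \<in> points T" "0 \<le> t" "t \<le> togo p"
  shows "flow t p \<in> points T"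
  using flow_in_path [OF assms] by (simp add: path_between_def)

lemma togo_flow:
  assumes "p \<in> points T" "0 \<le> t" "t \<le> togo p"
  shows "togo (flow t p) = togo p - t"
  using flow_in_path [OF assms] by (simp add: path_between_def)

lemma flow_unique:
  assumes "p \<in> points T" "q \<in> path_between T p v" "path_dist T p q = t"
  shows "flow t p = q"
proof -
  have "0 \<le> t" "t \<le> togo p"
    using assms path_dist_nonneg [of T p q] path_dist_nonneg [of T q v]
    by (auto simp: path_between_def)
  from geodesic [OF assms(1) this] flow_in_path [OF assms(1) this] assms show ?thesis
    by auto
qed

lemma path_refl: "p \<in> points T \<Longrightarrow> p \<in> path_between T p v"
  by (simp add: path_between_def)

lemma flow_0: "p \<in> points T \<Longrightarrow> flow 0 p = p"
  by (rule flow_unique) (simp_all add: path_refl)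

text \<open>Points at distance 0 are equally far from \<open>v\<close>, so both are the point at
  parameter 0 on the same geodesic to \<open>v\<close>.\<close>

lemma dist_0_eq:
  assumes "p \<in> points T" "q \<in> points T" "path_dist T p q = 0"
  shows "p = q"
proof -
  have "togo p = togo q"
    using path_dist_triangle [of T p v q] path_dist_triangle [of T q v p] assms
    by (simp add: path_dist_commute)
  then have "q \<in> path_between T p v"
    using assms by (simp add: path_between_def)
  from flow_unique [OF assms(1) this assms(3)] show ?thesis
    using flow_0 assms by simp
qed

lemma path_antisym:
  assumes "p \<in> points T" "q \<in> path_between T p v" "togo p \<le> togo q"
  shows "q = p"
proof -
  have "path_dist T p q = 0"
    using assms path_dist_nonneg [of T p q] by (simp add: path_between_def)
  moreover have "q \<in> points T"
    using assms by (simp add: path_between_def)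
  ultimately show ?thesis
    using dist_0_eq assms(1) by blast
qed

lemma togo_pos: "p \<in> points T \<Longrightarrow> p \<noteq> v \<Longrightarrow> 0 < togo p"
  using dist_0_eq [of p v] target path_dist_nonneg [of T p v] by fastforce

lemma flow_flow:
  assumes "p \<in> points T" "0 \<le> t" "0 \<le> s" "t + s \<le> togo p"
  shows "flow s (flow t p) = flow (t + s) p"
proof -
  let ?q = "flow t p"
  have q: "?q \<in> points T" "?q \<in> path_between T p v" "togo ?q = togo p - t" "path_dist T p ?q = t"
    using flow_point togo_flow flow_in_path assms by auto
  have r: "flow s ?q \<in> path_between T ?q v" "togo (flow s ?q) = togo p - t - s"
    using flow_in_path togo_flow q assms by auto
  have m: "flow s ?q \<in> path_between T p v"
    using path_between_trans q r by blast
  then have "path_dist T p (flow s ?q) = t + s"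
    using r by (simp add: path_between_def)
  from flow_unique [OF assms(1) m this] show ?thesis ..
qed

lemma dist_flow:
  assumes "p \<in> points T" "0 \<le> t" "t \<le> s" "s \<le> togo p"
  shows "path_dist T (flow t p) (flow s p) = s - t"
  using flow_flow [of p t "s - t"] flow_in_path(2) [of "flow t p" "s - t"] flow_point [of p t]
    togo_flow [of p t] assms by simp

section \<open>Times at which one moving server blocks another\<close>

lemma dist_flow_le:
  assumes "p \<in> points T" "t \<in> {0..togo p}" "s \<in> {0..togo p}"
  shows "path_dist T (flow t p) (flow s p) \<le> \<bar>t - s\<bar>"
  using dist_flow [of p t s] dist_flow [of p s t] assms
  by (cases "t \<le> s") (auto simp: path_dist_commute)

text \<open>At equal speeds the difference of the distances to \<open>v\<close> is constant in time,
  so blocking means that \<open>q\<close>, ahead by this fixed lag, is where \<open>p\<close> is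
  now. This turns blocking into the vanishing of a real function of \<open>t\<close>.\<close>

lemma flow_blocks_iff:
  assumes "p \<in> points T" "q \<in> points T" "0 \<le> t" "t \<le> togo p" "t \<le> togo q"
  shows "flow t p \<in> path_between T (flow t q) v \<longleftrightarrow>
    togo p \<le> togo q \<and> path_dist T (flow t p) (flow (t + (togo q - togo p)) q) = 0"
    (is "?l \<longleftrightarrow> ?r")
proof
  assume ?l
  then have d: "path_dist T (flow t q) (flow t p) = togo q - togo p"
    using togo_flow assms by (simp add: path_between_def)
  then have le: "togo p \<le> togo q"
    using path_dist_nonneg [of T "flow t q" "flow t p"] by simp
  have "flow t p = flow (togo q - togo p) (flow t q)"
    using flow_unique [OF _ \<open>?l\<close> d] flow_point assms by simp
  also have "\<dots> = flow (t + (togo q - togo p)) q"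
    using flow_flow assms le by simp
  finally show ?r
    using le by simp
next
  assume r: ?r
  have "flow t p = flow (t + (togo q - togo p)) q"
    by (rule dist_0_eq) (use r flow_point assms in auto)
  also have "\<dots> = flow (togo q - togo p) (flow t q)"
    using flow_flow assms r by simp
  finally show ?l
    using flow_in_path(1) [of "flow t q" "togo q - togo p"] flow_point togo_flow assms r
    by simp
qed

text \<open>Both points in \<open>f\<close> move at unit speed, so \<open>f\<close> is 2-Lipschitz
  and its zero set is closed. Closedness makes the first blocking time exist.\<close>

lemma closed_blocking_times:
  assumes "p \<in> points T" "q \<in> points T" "M \<le> togo p" "M \<le> togo q"
  shows "closed {t \<in> {0..M}. flow t p \<in> path_between T (flow t q) v}"
proof (cases "togo p \<le> togo q")
  case False
  then have "{t \<in> {0..M}. flow t p \<in> path_between T (flow t q) v} = {}"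
    using assms by (auto simp: flow_blocks_iff)
  then show ?thesis
    by (metis closed_empty)
next
  case True
  define f where "f t = path_dist T (flow t p) (flow (t + (togo q - togo p)) q)" for t
  have lip: "f t \<le> f s + 2 * \<bar>t - s\<bar>" if "t \<in> {0..M}" "s \<in> {0..M}" for s t
  proof -
    let ?t = "t + (togo q - togo p)" and ?s = "s + (togo q - togo p)"
    have 1: "path_dist T (flow t p) (flow s p) \<le> \<bar>t - s\<bar>"
      using that assms by (intro dist_flow_le) auto
    have "path_dist T (flow ?s q) (flow ?t q) \<le> \<bar>?s - ?t\<bar>"
      using that assms True by (intro dist_flow_le) auto
    then have 2: "path_dist T (flow ?s q) (flow ?t q) \<le> \<bar>t - s\<bar>"
      by simp
    have "f t \<le> path_dist T (flow t p) (flow s p) + path_dist T (flow s p) (flow ?t q)"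
      unfolding f_def by (rule path_dist_triangle)
    also have "\<dots> \<le> \<bar>t - s\<bar> + (f s + \<bar>t - s\<bar>)"
      unfolding f_def
      by (intro add_mono 1 order_trans [OF path_dist_triangle add_left_mono [OF 2]])
    finally show ?thesis
      by simp
  qed
  have "continuous_on {0..M} f"
  proof (rule continuous_onI)
    fix x e :: real
    assume x: "x \<in> {0..M}" and "e > 0"
    then show "\<exists>d>0. \<forall>x'\<in>{0..M}. dist x' x < d \<longrightarrow> dist (f x') (f x) \<le> e"
      using lip [OF x] lip [OF _ x]
      by (intro exI [of _ "e / 2"]) (force simp: dist_real_def abs_le_iff abs_minus_commute)
  qed
  then have "closed {t \<in> {0..M}. f t = 0}"
    by (intro continuous_closed_preimage_constant) auto
  moreover have "{t \<in> {0..M}. flow t p \<in> path_between T (flow t q) v} = {t \<in> {0..M}. f t = 0}"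
    using assms True by (auto simp: flow_blocks_iff f_def)
  ultimately show ?thesis
    by simp
qed

section \<open>Adjacency during a stage\<close>

lemma adjacent_on_path:
  assumes "set_mset A \<subseteq> points T" "x \<in># A"
  obtains p where "p \<in> adjacent T v A" "p \<in> path_between T x v"
proof -
  let ?X = "set_mset A \<inter> path_between T x v"
  have "finite ?X" "?X \<noteq> {}"
    using path_refl [of x] assms by blast+
  then obtain p where p: "p \<in> ?X" "\<And>q. q \<in> ?X \<Longrightarrow> togo p \<le> togo q"
    using arg_min_if_finite [of ?X togo] by (meson not_le)
  have "q = p" if "q \<in> path_between T p v" "q \<in># A" for q
  proof (rule path_antisym [OF _ that(1)])
    show "p \<in> points T"
      using p(1) assms by blast
    show "togo p \<le> togo q"
      using that p path_between_trans by blast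
  qed
  then have "p \<in> adjacent T v A"
    unfolding adjacent_def using p(1) assms path_refl by blast
  then show ?thesis
    using that p by blast
qed

text \<open>A blocked server that stands still remains blocked, because its blocker only moves
  further along the same path.\<close>

lemma adjacent_advance_subset:
  assumes "set_mset A \<subseteq> points T" "0 \<le> t" "\<And>p. p \<in> adjacent T v A \<Longrightarrow> t \<le> togo p"
  shows "adjacent T v (advance T v (adjacent T v A) t A) \<subseteq> flow t ` adjacent T v A"
proof
  fix x
  let ?A' = "advance T v (adjacent T v A) t A"
  assume x: "x \<in> adjacent T v ?A'"
  then have "x \<in># ?A'"
    by (simp add: adjacent_def)
  then consider "x \<in> flow t ` adjacent T v A" | "x \<in># A"
    using set_mset_advance_adjacent by blast
  then show "x \<in> flow t ` adjacent T v A"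
  proof cases
    case 2
    then obtain p where p: "p \<in> adjacent T v A" "p \<in> path_between T x v"
      using adjacent_on_path assms by blast
    then have "p \<in> points T"
      using assms by (auto simp: adjacent_def)
    then have "flow t p \<in> path_between T x v"
      using p assms flow_in_path(1) path_between_trans by blast
    moreover have "flow t p \<in># ?A'"
      using p(1) by (rule advance_adjacentI)
    ultimately have "flow t p = x"
      using x by (auto simp: adjacent_def)
    then show ?thesis
      using p by blast
  qed
qed

lemma adjacent_advance:
  assumes A: "set_mset A \<subseteq> points T" and t: "0 \<le> t" "\<And>p. p \<in> adjacent T v A \<Longrightarrow> t \<le> togo p"
    and free: "\<And>p q. \<lbrakk>p \<in> adjacent T v A; q \<in> adjacent T v A; p \<noteq> q\<rbrakk>
      \<Longrightarrow> flow t p \<notin> path_between T (flow t q) v"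
  shows "adjacent T v (advance T v (adjacent T v A) t A) = flow t ` adjacent T v A"
proof (rule antisym [OF adjacent_advance_subset [OF A t] image_subsetI])
  let ?A' = "advance T v (adjacent T v A) t A"
  fix p
  assume p: "p \<in> adjacent T v A"
  have pp: "p \<in> points T"
    using p A by (auto simp: adjacent_def)
  have "q = flow t p" if q: "q \<in># ?A'" "q \<in> path_between T (flow t p) v" for q
  proof -
    consider r where "r \<in> adjacent T v A" "q = flow t r" | "q \<in># A"
      using set_mset_advance_adjacent q(1) by blast
    then show ?thesis
    proof cases
      case 1
      then show ?thesis
        using free q p by blast
    next
      case 2
      have on: "flow t p \<in> path_between T p v"
        using flow_in_path pp t p by simp
      then have "q \<in> path_between T p v"
        using q path_between_trans by blast
      then have "q = p"
        using 2 p by (auto simp: adjacent_def)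
      \<comment> \<open>A copy left behind at \<open>p\<close> can be ahead of
        \<open>flow t p\<close> only if \<open>p\<close> has not moved at all.\<close>
      then show ?thesis
        using path_antisym [OF pp on] q togo_flow [OF pp t(1) t(2) [OF p]]
          path_dist_nonneg [of T "flow t p" q]
        by (simp add: path_between_def)
    qed
  qed
  moreover have "flow t p \<in> points T"
    using flow_point pp t p by simp
  moreover have "flow t p \<in># ?A'"
    using p by (rule advance_adjacentI)
  ultimately show "flow t p \<in> adjacent T v ?A'"
    unfolding adjacent_def using path_refl by blast
qed

section \<open>Existence of the motion\<close>

lemma advance_points:
  assumes "set_mset A \<subseteq> points T" "0 \<le> t" "\<And>p. p \<in> adjacent T v A \<Longrightarrow> t \<le> togo p"
  shows "set_mset (advance T v (adjacent T v A) t A) \<subseteq> points T"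
proof -
  have "flow t ` adjacent T v A \<subseteq> points T"
    using assms flow_point by (auto simp: adjacent_def)
  then show ?thesis
    using set_mset_advance_adjacent [of T v A t] assms by blast
qed

text \<open>A stage ends when a server reaches \<^term>\<open>v\<close> or gets in the way of another moving one. In the
  second case fewer servers are adjacent afterwards.\<close>

lemma dc_serve_exists:
  assumes "set_mset A \<subseteq> points T" "A \<noteq> {#}"
  shows "\<exists>B c. dc_serve T v A B c"
  using assms
proof (induction "card (adjacent T v A)" arbitrary: A rule: less_induct)
  case less
  note A = less.prems(1)
  show ?case
  proof (cases "v \<in># A")
    case True
    then show ?thesis
      using served by blast
  next
    case v: False
    define S where "S = adjacent T v A"
    have finS: "finite S" and S: "S \<subseteq> set_mset A" "S \<subseteq> points T"
      using A by (auto simp: S_def adjacent_def)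
    have "S \<noteq> {}"
      using less.prems adjacent_on_path [OF A] unfolding S_def
      by (metis empty_iff multiset_nonemptyE)
    define M where "M = Min (togo ` S)"
    have M: "M \<le> togo p" if "p \<in> S" for p
      using that finS by (simp add: M_def)
    obtain p0 where p0: "p0 \<in> S" "togo p0 = M"
      using Min_in [of "togo ` S"] finS \<open>S \<noteq> {}\<close> unfolding M_def
      by (metis finite_imageI image_iff image_is_empty)
    have "M > 0"
      using p0 togo_pos [of p0] S v by auto
    define C where "C = (\<Union>p\<in>S. \<Union>q\<in>S - {p}.
      {t \<in> {0..M}. flow t p \<in> path_between T (flow t q) v})"
    have "closed C"
      unfolding C_def using S M finS
      by (intro closed_UN) (auto intro!: closed_blocking_times simp del: atLeastAtMost_iff)
    \<comment> \<open>\<open>C\<close> collects the blocking times up to \<open>M\<close>, the first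
      arrival at \<open>v\<close>. Inserting \<open>M\<close> makes the set nonempty; as the set is
      closed, its infimum is attained and one of the two events does occur at time \<delta>.\<close>
    define \<delta> where "\<delta> = Inf (insert M C)"
    have bdd: "bdd_below (insert M C)" and C0: "C \<subseteq> {0..M}"
      by (auto simp: C_def intro!: bdd_belowI [of _ 0] less_imp_le [OF \<open>M > 0\<close>])
    have \<delta>: "\<delta> \<in> insert M C"
      unfolding \<delta>_def using \<open>closed C\<close> bdd by (intro closed_contains_Inf) auto
    then have "\<delta> \<le> M"
      using C0 by auto
    have "p \<notin> path_between T q v" if "p \<in> S" "q \<in> S" "p \<noteq> q" for p q
      using that unfolding S_def adjacent_def by blast
    moreover have "flow 0 p = p" if "p \<in> S" for p
      using that S flow_0 by blast
    ultimately have "0 \<notin> C"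
      unfolding C_def by auto
    then have "0 \<le> \<delta>" "\<delta> \<noteq> 0"
      using \<delta> C0 \<open>M > 0\<close> by auto
    then have "\<delta> > 0"
      by simp
    have early: "t \<notin> C" "t < M" if "t < \<delta>" for t
      using that \<open>\<delta> \<le> M\<close> cInf_lower [OF _ bdd, of t] by (auto simp: \<delta>_def)
    let ?A' = "advance T v S \<delta> A"
    have A': "set_mset ?A' \<subseteq> points T"
      unfolding S_def using A \<open>\<delta> > 0\<close> \<open>\<delta> \<le> M\<close> M
      by (intro advance_points) (auto simp: S_def intro: order_trans)
    have "\<exists>B c. dc_serve T v ?A' B c"
    proof (cases "\<delta> = M")
      case True
      have "togo (flow M p0) = 0" "flow M p0 \<in> points T"
        using togo_flow [of p0 M] flow_point [of p0 M] p0 S \<open>M > 0\<close> by auto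
      then have "flow M p0 = v"
        using togo_pos by fastforce
      then have "v \<in># ?A'"
        using advance_adjacentI [of p0 T v A M] p0 True by (simp add: S_def)
      then show ?thesis
        using served by blast
    next
      case False
      with \<delta> obtain p q where pq: "p \<in> S" "q \<in> S" "p \<noteq> q"
        "flow \<delta> p \<in> path_between T (flow \<delta> q) v"
        by (auto simp: C_def)
      have sub: "adjacent T v ?A' \<subseteq> flow \<delta> ` S"
        unfolding S_def using A \<open>\<delta> > 0\<close> \<open>\<delta> \<le> M\<close> M
        by (intro adjacent_advance_subset) (auto simp: S_def intro: order_trans)
      \<comment> \<open>Either two servers meet, so that \<open>flow \<delta>\<close> is not
        injective on \<open>S\<close>, or one hides the other, which then ceases to be
        adjacent.\<close>
      have "card (adjacent T v ?A') < card S"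
      proof (cases "flow \<delta> p = flow \<delta> q")
        case True
        then have "\<not> inj_on (flow \<delta>) S"
          using pq by (auto dest: inj_onD)
        then have "card (flow \<delta> ` S) < card S"
          using finS by (metis card_image_le inj_on_iff_eq_card order_le_less)
        then show ?thesis
          using card_mono [OF _ sub] finS by simp
      next
        case False
        then have "flow \<delta> q \<notin> adjacent T v ?A'"
          using pq advance_adjacentI [of p T v A \<delta>] by (auto simp: adjacent_def S_def)
        then have "adjacent T v ?A' \<subset> flow \<delta> ` S"
          using sub pq by blast
        then show ?thesis
          using finS by (meson card_image_le finite_imageI order_less_le_trans psubset_card_mono)
      qed
      moreover have "?A' \<noteq> {#}"
        using less.prems by (metis S_def size_advance_adjacent size_eq_0_iff_empty)
      ultimately show ?thesis
        using less.hyps [of ?A'] A' by (simp add: S_def)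
    qed
    then obtain B c where B: "dc_serve T v ?A' B c"
      by blast
    have "dc_serve T v A B (real (card S) * \<delta> + c)"
    proof (rule stage [OF S_def \<open>\<delta> > 0\<close> _ B])
      fix t
      assume t: "0 \<le> t" "t < \<delta>"
      have tM: "t < togo p" if "p \<in> S" for p
        using M [OF that] early(2) [OF t(2)] by simp
      have tM': "t \<in> {0..M}"
        using early(2) [OF t(2)] t by simp
      have free: "flow t p \<notin> path_between T (flow t q) v" if "p \<in> S" "q \<in> S" "p \<noteq> q" for p q
        using early(1) [OF t(2)] tM' that unfolding C_def by blast
      have "v \<noteq> flow t p" if "p \<in> S" for p
      proof -
        have "0 < togo (flow t p)"
          using togo_flow [of p t] tM [OF that] subsetD [OF S(2) that] t(1) by simp
        then show ?thesis
          using path_dist_self [of T v] by (intro notI) (simp only: less_irrefl)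
      qed
      then have 1: "v \<notin># advance T v S t A"
        using set_mset_advance_adjacent [of T v A t] v by (auto simp: S_def)
      have "flow t p \<in> points T" if "p \<in> S" for p
        using flow_point [of p t] tM [OF that] subsetD [OF S(2) that] t(1) by simp
      then have 2: "inj_on (flow t) S"
        using free path_refl by (metis inj_onI)
      have 3: "adjacent T v (advance T v S t A) = flow t ` S"
        unfolding S_def using A t tM free
        by (intro adjacent_advance) (auto simp: S_def less_imp_le)
      show "v \<notin># advance T v S t A \<and> inj_on (flow t) S \<and>
          adjacent T v (advance T v S t A) = flow t ` S"
        using 1 2 3 by blast
    qed
    then show ?thesis
      by blast
  qed
qed

section \<open>Induction over stages and its first consequences\<close>

lemma dc_serve_induct [consumes 2, case_names served stage]:
  assumes "dc_serve T v A B c" "set_mset A \<subseteq> points T"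
    and served: "\<And>A. v \<in># A \<Longrightarrow> set_mset A \<subseteq> points T \<Longrightarrow> P A A 0"
    and stage: "\<And>A A' S \<delta> B c.
      \<lbrakk>set_mset A \<subseteq> points T; S = adjacent T v A; 0 < \<delta>;
        \<And>p. p \<in> S \<Longrightarrow> \<delta> \<le> togo p;
        \<And>t. 0 \<le> t \<Longrightarrow> t < \<delta> \<Longrightarrow> inj_on (flow t) S \<and>
          adjacent T v (advance T v S t A) = flow t ` S;
        A' = advance T v S \<delta> A; set_mset A' \<subseteq> points T; dc_serve T v A' B c; P A' B c\<rbrakk>
      \<Longrightarrow> P A B (real (card S) * \<delta> + c)"
  shows "P A B c"
  using assms(1,2)
proof (induction rule: dc_serve.induct)
  case (served A)
  then show ?case
    by (rule assms(3))
next
  case (stage S A \<delta> B c)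
  \<comment> \<open>A server with less than \<delta> to go would occupy \<open>v\<close> at time
    \<open>togo p\<close>, before the end of the stage, which \<open>stage\<close> forbids.\<close>
  have le: "\<delta> \<le> togo p" if "p \<in> S" for p
  proof (rule ccontr)
    assume "\<not> \<delta> \<le> togo p"
    then have v: "v \<notin># advance T v S (togo p) A"
      using stage.hyps(3) [of "togo p"] path_dist_nonneg [of T p v] by simp
    have p: "p \<in> points T"
      using that stage by (auto simp: adjacent_def)
    then have "togo (flow (togo p) p) = 0" "flow (togo p) p \<in> points T"
      using togo_flow flow_point path_dist_nonneg [of T p v] by simp_all
    then have "flow (togo p) p = v"
      using togo_pos by fastforce
    then show False
      using v advance_adjacentI [of p T v A "togo p"] that stage.hyps(1) by simp
  qed
  have A': "set_mset (advance T v S \<delta> A) \<subseteq> points T"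
    using advance_points [OF stage.prems, of \<delta>] le stage.hyps(1,2) by simp
  show ?case
    using stage.hyps le A' stage.IH [OF A'] by (intro assms(4) [OF stage.prems]) auto
qed

lemma dc_serve_config:
  assumes "dc_serve T v A B c" "set_mset A \<subseteq> points T"
  shows "set_mset B \<subseteq> points T \<and> size B = size A \<and> v \<in># B \<and> 0 \<le> c"
  using assms by (induction rule: dc_serve_induct) auto

text \<open>A stage brings each server at most \<delta> closer to \<open>v\<close> and costs at
  least \<delta>, since some server is adjacent. Hence a cheap request needs a server
  nearby.\<close>

lemma dc_serve_cost_ge:
  assumes "dc_serve T v A B c" "set_mset A \<subseteq> points T" "A \<noteq> {#}"
  shows "\<exists>p. p \<in># A \<and> togo p \<le> c"
  using assms
proof (induction rule: dc_serve_induct)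
  case (served A)
  then show ?case
    by (intro exI [of _ v]) simp
next
  case (stage A A' S \<delta> B c)
  have "A' \<noteq> {#}"
    using stage by (metis size_advance_adjacent size_eq_0_iff_empty)
  then obtain p where p: "p \<in># A'" "togo p \<le> c"
    using stage.IH by blast
  have S: "finite S" "S \<noteq> {}"
    using adjacent_on_path [OF stage.hyps(1)] stage.prems stage.hyps(2)
    by (metis finite_adjacent, metis empty_iff multiset_nonemptyE)
  then have "1 * \<delta> \<le> real (card S) * \<delta>"
    using \<open>0 < \<delta>\<close> by (intro mult_right_mono) (auto simp: Suc_le_eq card_gt_0_iff)
  consider "p \<in># A" | q where "q \<in> S" "p = flow \<delta> q"
    using p set_mset_advance_adjacent [of T v A \<delta>] stage.hyps by blast
  then show ?case
  proof cases
    case 1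
    then show ?thesis
      using p \<open>0 < \<delta>\<close> by (intro exI [of _ p]) (simp add: add_increasing)
  next
    case 2
    then have q: "q \<in># A"
      using stage.hyps by (auto simp: adjacent_def)
    then have "togo p = togo q - \<delta>"
      using togo_flow [of q \<delta>] 2 stage.hyps by auto
    then show ?thesis
      using p q \<open>1 * \<delta> \<le> real (card S) * \<delta>\<close> by (intro exI [of _ q]) simp
  qed
qed

end

section \<open>The two-level tree\<close>

definition broom :: "real \<Rightarrow> nat \<Rightarrow> nat \<Rightarrow> rtree" where
  "broom \<sigma> m h =
    \<lparr>nodes = {[]} \<union> (\<lambda>a. [a]) ` {..<m} \<union> (\<lambda>(a, b). [a, b]) ` ({..<m} \<times> {..<h}),
     len = (\<lambda>u. if length u = 1 then \<sigma> else 1)\<rparr>"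

lemma nodes_broom:
  "u \<in> nodes (broom \<sigma> m h) \<longleftrightarrow>
    u = [] \<or> (\<exists>a<m. u = [a]) \<or> (\<exists>a<m. \<exists>b<h. u = [a, b])"
  by (auto simp: broom_def)

lemma len_broom [simp]: "len (broom \<sigma> m h) u = (if length u = 1 then \<sigma> else 1)"
  by (simp add: broom_def)

lemma edge_weighted_tree_broom: "0 < \<sigma> \<Longrightarrow> edge_weighted_tree (broom \<sigma> m h)"
  unfolding edge_weighted_tree_def nodes_broom
  by (auto simp: broom_def append_eq_Cons_conv)

lemma leaves_broom:
  assumes "0 < m" "0 < h"
  shows "leaves (broom \<sigma> m h) = (\<lambda>(a, b). [a, b]) ` ({..<m} \<times> {..<h})"
  using assms unfolding leaves_def nodes_broom by (auto simp: append_eq_Cons_conv)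

lemma depth_hst_broom:
  assumes "1 < \<sigma>" "0 < m" "0 < h"
  shows "depth_hst \<sigma> 2 (broom \<sigma> m h)"
  using assms edge_weighted_tree_broom [of \<sigma> m h]
  by (auto simp: depth_hst_def depth_tree_def leaves_broom nodes_broom append_eq_Cons_conv)

lemma broom_point_cases:
  assumes "p \<in> points (broom \<sigma> m h)"
  obtains (root) "p = ([], 0)"
  | (arm) a x where "p = ([a], x)" "a < m" "0 \<le> x" "x < \<sigma>"
  | (twig) a b x where "p = ([a, b], x)" "a < m" "b < h" "0 \<le> x" "x < 1"
  using assms by (cases p) (auto simp: points_def nodes_broom)

lemma broom_points [simp]:
  "([], x) \<in> points (broom \<sigma> m h) \<longleftrightarrow> x = 0"
  "([a], x) \<in> points (broom \<sigma> m h) \<longleftrightarrow> a < m \<and> 0 \<le> x \<and> x < \<sigma>"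
  "([a, b], x) \<in> points (broom \<sigma> m h) \<longleftrightarrow> a < m \<and> b < h \<and> 0 \<le> x \<and> x < 1"
  by (auto simp: points_def nodes_broom)

lemma covered_broom [simp]:
  "covered (broom \<sigma> m h) ([], x) (a # l) = 0"
  "covered (broom \<sigma> m h) ([a], x) [a'] = (if a' = a then \<sigma> - x else 0)"
  "covered (broom \<sigma> m h) ([a], x) [a', b'] = 0"
  "covered (broom \<sigma> m h) ([a, b], x) [a'] = (if a' = a then \<sigma> else 0)"
  "covered (broom \<sigma> m h) ([a, b], x) [a', b'] = (if a' = a \<and> b' = b then 1 - x else 0)"
  by (auto simp: covered_def strict_prefix_def)

definition edges :: "rtree \<Rightarrow> nat list set" where
  "edges T = nodes T - {[]}"

lemma finite_edges_broom [simp]: "finite (edges (broom \<sigma> m h))"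
  by (simp add: edges_def broom_def)

lemma edges_broom:
  "e \<in> edges (broom \<sigma> m h) \<longleftrightarrow> (\<exists>a<m. e = [a]) \<or> (\<exists>a<m. \<exists>b<h. e = [a, b])"
  by (auto simp: edges_def nodes_broom)

lemma covered_broom_nonneg:
  assumes "0 < \<sigma>" "p \<in> points (broom \<sigma> m h)" "e \<in> edges (broom \<sigma> m h)"
  shows "0 \<le> covered (broom \<sigma> m h) p e"
  using assms(2)
  by (cases rule: broom_point_cases) (use assms(1,3) in \<open>auto simp: edges_broom\<close>)

definition root_dist :: "rtree \<Rightarrow> point \<Rightarrow> real" where
  "root_dist T p = (\<Sum>e\<in>edges T. covered T p e)"

lemma root_dist_broom:
  "root_dist (broom \<sigma> m h) ([], x) = 0"
  "a < m \<Longrightarrow> root_dist (broom \<sigma> m h) ([a], x) = \<sigma> - x"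
  "a < m \<Longrightarrow> b < h \<Longrightarrow> root_dist (broom \<sigma> m h) ([a, b], x) = \<sigma> + 1 - x"
proof -
  show "root_dist (broom \<sigma> m h) ([], x) = 0"
    unfolding root_dist_def by (rule sum.neutral) (auto simp: edges_broom)
  show "root_dist (broom \<sigma> m h) ([a], x) = \<sigma> - x" if "a < m"
  proof -
    have "root_dist (broom \<sigma> m h) ([a], x) = (\<Sum>e\<in>{[a]}. covered (broom \<sigma> m h) ([a], x) e)"
      unfolding root_dist_def
      using that by (intro sum.mono_neutral_right) (auto simp: edges_broom split: if_splits)
    then show ?thesis
      by simp
  qed
  show "root_dist (broom \<sigma> m h) ([a, b], x) = \<sigma> + 1 - x" if "a < m" "b < h"
  proof -
    have "root_dist (broom \<sigma> m h) ([a, b], x) =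
        (\<Sum>e\<in>{[a], [a, b]}. covered (broom \<sigma> m h) ([a, b], x) e)"
      unfolding root_dist_def
      using that by (intro sum.mono_neutral_right) (auto simp: edges_broom split: if_splits)
    then show ?thesis
      by simp
  qed
qed

text \<open>The detour through the root is long enough, and no point is further than \<sigma> + 1
  from the root.\<close>

lemma path_dist_broom_le:
  assumes "0 < \<sigma>" "p \<in> points (broom \<sigma> m h)" "q \<in> points (broom \<sigma> m h)"
  shows "path_dist (broom \<sigma> m h) p q \<le> 2 * (\<sigma> + 1)"
proof -
  have le: "root_dist (broom \<sigma> m h) p \<le> \<sigma> + 1" if "p \<in> points (broom \<sigma> m h)" for p
    using that by (cases rule: broom_point_cases) (use assms in \<open>auto simp: root_dist_broom\<close>)
  have "path_dist (broom \<sigma> m h) p q \<le> root_dist (broom \<sigma> m h) p + root_dist (broom \<sigma> m h) q"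
    unfolding path_dist_def root_dist_def edges_def [symmetric] sum.distrib [symmetric]
  proof (rule sum_mono)
    fix e
    assume "e \<in> edges (broom \<sigma> m h)"
    then have "0 \<le> covered (broom \<sigma> m h) p e" "0 \<le> covered (broom \<sigma> m h) q e"
      using covered_broom_nonneg assms by blast+
    then show "\<bar>covered (broom \<sigma> m h) p e - covered (broom \<sigma> m h) q e\<bar>
        \<le> covered (broom \<sigma> m h) p e + covered (broom \<sigma> m h) q e"
      by linarith
  qed
  then show ?thesis
    using le [OF assms(2)] le [OF assms(3)] by simp
qed

text \<open>The spine is the path from the root to the requested leaf \<^term>\<open>v\<close>. A server first travels
  the distance \<open>off\<close> to the spine and then moves down along it; \<open>dep\<close> is the distance between
  the root and its projection to the spine.\<close>

locale broom_request =
  fixes \<sigma> :: real and m h s j :: nat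
  assumes \<sigma>: "0 < \<sigma>" and s: "s < m" and j: "j < h"
begin

abbreviation "T \<equiv> broom \<sigma> m h"
abbreviation "v \<equiv> ([s, j], 0 :: real)"

definition side :: "nat list set" where
  "side = edges T - {[s], [s, j]}"

definition off :: "point \<Rightarrow> real" where
  "off p = (\<Sum>e\<in>side. covered T p e)"

definition dep :: "point \<Rightarrow> real" where
  "dep p = covered T p [s] + covered T p [s, j]"

lemma finite_side [simp]: "finite side"
  by (simp add: side_def)

lemma side_iff:
  "e \<in> side \<longleftrightarrow> (\<exists>a<m. a \<noteq> s \<and> e = [a]) \<or> (\<exists>a<m. \<exists>b<h. (a \<noteq> s \<or> b \<noteq> j) \<and> e = [a, b])"
  using s j by (auto simp: side_def edges_broom)

lemma edges_eq: "edges T = insert [s] (insert [s, j] side)"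
  using s j by (auto simp: side_def edges_broom)

lemma sum_edges:
  "(\<Sum>e\<in>edges T. f e) = f [s] + f [s, j] + (\<Sum>e\<in>side. f e)" for f :: "nat list \<Rightarrow> real"
proof -
  have "[s] \<notin> insert [s, j] side" "[s, j] \<notin> side"
    by (auto simp: side_def)
  then show ?thesis
    by (simp add: edges_eq)
qed

lemma off_eq: "off p = root_dist T p - dep p"
  by (simp add: root_dist_def sum_edges off_def dep_def)

lemma off_dep_simps [simp]:
  "off ([], x) = 0" "dep ([], x) = 0"
  "a < m \<Longrightarrow> off ([a], x) = (if a = s then 0 else \<sigma> - x)"
  "dep ([a], x) = (if a = s then \<sigma> - x else 0)"
  "a < m \<Longrightarrow> b < h \<Longrightarrow>
    off ([a, b], x) = (if a = s then if b = j then 0 else 1 - x else \<sigma> + 1 - x)"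
  "dep ([a, b], x) = (if a = s then if b = j then \<sigma> + 1 - x else \<sigma> else 0)"
  by (auto simp: off_eq root_dist_broom dep_def)

lemma target_point: "v \<in> points T"
  using s j by simp

lemma off_nonneg: "p \<in> points T \<Longrightarrow> 0 \<le> off p"
  by (cases rule: broom_point_cases) (use \<sigma> in auto)

lemma dep_bounds: "p \<in> points T \<Longrightarrow> 0 \<le> dep p \<and> dep p \<le> \<sigma> + 1"
  by (cases rule: broom_point_cases) (use \<sigma> in auto)

text \<open>The lower spine edge is entered only after the upper one is fully covered, so
  \<open>dep\<close> alone determines both.\<close>

lemma covered_spine:
  assumes "p \<in> points T"
  shows "covered T p [s] = min (dep p) \<sigma>" "covered T p [s, j] = max 0 (dep p - \<sigma>)"
  using assms by (cases rule: broom_point_cases; use \<sigma> in auto)+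

text \<open>Branches leave the spine only at the root and at \<open>[s]\<close>.\<close>

lemma dep_off_spine: "p \<in> points T \<Longrightarrow> 0 < off p \<Longrightarrow> dep p = 0 \<or> dep p = \<sigma>"
  by (cases rule: broom_point_cases) (auto split: if_splits)

section \<open>Distances and paths towards the requested leaf\<close>

lemma dist_target: "p \<in> points T \<Longrightarrow> path_dist T p v = off p + \<sigma> + 1 - dep p"
proof -
  assume p: "p \<in> points T"
  have "(\<Sum>e\<in>side. \<bar>covered T p e - covered T v e\<bar>) = off p"
    unfolding off_def
  proof (rule sum.cong)
    fix e
    assume e: "e \<in> side"
    then have "0 \<le> covered T p e"
      using covered_broom_nonneg \<sigma> p by (simp add: side_def)
    then show "\<bar>covered T p e - covered T v e\<bar> = covered T p e"
      using e by (auto simp: side_iff)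
  qed simp
  then show ?thesis
    using covered_spine [OF p] dep_bounds [OF p]
    by (simp add: path_dist_def edges_def [symmetric] sum_edges)
qed

text \<open>The triangle inequality is tight iff it is tight on every edge. Spine edges are fully
  covered by \<open>v\<close>, so coverage may only grow there; side edges are not covered by
  \<open>v\<close>, so it may only shrink. The two spine conditions merge into one on
  \<open>dep\<close>.\<close>

lemma path_iff:
  assumes "p \<in> points T" "z \<in> points T"
  shows "z \<in> path_between T p v \<longleftrightarrow> dep p \<le> dep z \<and> (\<forall>e\<in>side. covered T z e \<le> covered T p e)"
proof -
  let ?f = "\<lambda>e. \<bar>covered T p e - covered T z e\<bar> + \<bar>covered T z e - covered T v e\<bar>
    - \<bar>covered T p e - covered T v e\<bar>"
  have between: "\<bar>x - y\<bar> + \<bar>y - c\<bar> - \<bar>x - c\<bar> = 0 \<longleftrightarrow> x \<le> y" if "x \<le> c" "y \<le> c"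
    for x y c :: real
    using that by (simp add: abs_if)
  have v: "covered T v [s] = \<sigma>" "covered T v [s, j] = 1"
    by simp_all
  have vs: "covered T v e = 0" if "e \<in> side" for e
    using that by (auto simp: side_iff)
  have "z \<in> path_between T p v \<longleftrightarrow> (\<Sum>e\<in>edges T. ?f e) = 0"
    using assms by (simp add: path_between_def path_dist_def edges_def sum.distrib sum_subtractf)
  also have "\<dots> \<longleftrightarrow> (\<forall>e\<in>edges T. ?f e = 0)"
    by (intro sum_nonneg_eq_0_iff) auto
  also have "\<dots> \<longleftrightarrow> ?f [s] = 0 \<and> ?f [s, j] = 0 \<and> (\<forall>e\<in>side. ?f e = 0)"
    unfolding edges_eq by blast
  also have "(\<forall>e\<in>side. ?f e = 0) \<longleftrightarrow> (\<forall>e\<in>side. covered T z e \<le> covered T p e)"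
  proof (rule ball_cong [OF refl])
    fix e
    assume "e \<in> side"
    then have "0 \<le> covered T p e" "0 \<le> covered T z e" "covered T v e = 0"
      using covered_broom_nonneg \<sigma> assms vs by (auto simp: side_def)
    then show "?f e = 0 \<longleftrightarrow> covered T z e \<le> covered T p e"
      by auto
  qed
  also have "?f [s] = 0 \<longleftrightarrow> min (dep p) \<sigma> \<le> min (dep z) \<sigma>"
    unfolding v covered_spine(1) [OF assms(1)] covered_spine(1) [OF assms(2)]
    by (rule between) simp_all
  also have "?f [s, j] = 0 \<longleftrightarrow> max 0 (dep p - \<sigma>) \<le> max 0 (dep z - \<sigma>)"
    unfolding v covered_spine(2) [OF assms(1)] covered_spine(2) [OF assms(2)]
    by (rule between) (use dep_bounds [OF assms(1)] dep_bounds [OF assms(2)] in auto)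
  also have "min (dep p) \<sigma> \<le> min (dep z) \<sigma> \<and> max 0 (dep p - \<sigma>) \<le> max 0 (dep z - \<sigma>) \<and> X
      \<longleftrightarrow> dep p \<le> dep z \<and> X" for X
    by linarith
  finally show ?thesis .
qed

lemma dist_on_path:
  assumes "p \<in> points T" "z \<in> path_between T p v"
  shows "path_dist T p z = off p - off z + dep z - dep p"
  using assms dist_target [of p] dist_target [of z] by (auto simp: path_between_def)

lemma spine_eqI:
  assumes "p \<in> points T" "q \<in> points T" "off p = 0" "off q = 0" "dep p = dep q"
  shows "p = q"
  by (rule broom_point_cases [OF assms(1)]; rule broom_point_cases [OF assms(2)];
      use assms \<sigma> in \<open>auto split: if_splits\<close>)

lemma off_0_covered:
  assumes "p \<in> points T" "off p = 0" "e \<in> side"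
  shows "covered T p e = 0"
proof -
  have "\<forall>e\<in>side. covered T p e = 0"
    using assms(2) unfolding off_def
    by (subst (asm) sum_nonneg_eq_0_iff)
      (use covered_broom_nonneg [OF \<sigma> assms(1)] in \<open>auto simp: side_def\<close>)
  then show ?thesis
    using assms(3) by blast
qed

lemma spine_path:
  assumes "p \<in> points T" "z \<in> points T" "off z = 0" "dep p \<le> dep z"
  shows "z \<in> path_between T p v"
  using assms covered_broom_nonneg [OF \<sigma> assms(1)] off_0_covered [OF assms(2,3)]
  by (auto simp: path_iff side_def)

lemma spine_point_exists:
  assumes "0 \<le> r" "r \<le> \<sigma> + 1"
  shows "\<exists>z \<in> points T. off z = 0 \<and> dep z = r"
proof -
  consider "r = 0" | "0 < r" "r \<le> \<sigma>" | "\<sigma> < r"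
    using assms by linarith
  then show ?thesis
  proof cases
    case 1
    then show ?thesis
      by (intro bexI [of _ "([], 0)"]) auto
  next
    case 2
    then show ?thesis
      using s by (intro bexI [of _ "([s], \<sigma> - r)"]) auto
  next
    case 3
    then show ?thesis
      using s j assms by (intro bexI [of _ "([s, j], \<sigma> + 1 - r)"]) auto
  qed
qed

text \<open>\<open>p\<close> covers the side edge containing \<open>z\<close> at least as far as
  \<open>z\<close> does, hence lies on that edge or, if it is an arm, on a twig below it.\<close>

lemma off_path:
  assumes "p \<in> points T" "z \<in> path_between T p v" "0 < off z"
  shows "dep z = dep p"
    and "fst z = [a, b] \<Longrightarrow> fst p = [a, b]"
    and "fst z = [a] \<Longrightarrow> fst p = [a] \<or> (\<exists>b. fst p = [a, b])"
proof -
  have z: "z \<in> points T"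
    using assms(2) by (simp add: path_between_def)
  then have le: "covered T z e \<le> covered T p e" if "e \<in> side" for e
    using that assms(2) path_iff [OF assms(1)] by blast
  have *: "dep z = dep p \<and> (\<forall>a b. fst z = [a, b] \<longrightarrow> fst p = [a, b]) \<and>
      (\<forall>a. fst z = [a] \<longrightarrow> fst p = [a] \<or> (\<exists>b. fst p = [a, b]))"
    using z
  proof (cases rule: broom_point_cases)
    case root
    then show ?thesis
      using assms by simp
  next
    case (arm a x)
    then have "a \<noteq> s"
      using assms by auto
    then have "covered T z [a] \<le> covered T p [a]"
      using arm le [of "[a]"] by (simp add: side_iff)
    with assms(1) show ?thesis
      by (cases rule: broom_point_cases) (use arm \<open>a \<noteq> s\<close> in \<open>auto split: if_splits\<close>)
  next
    case (twig a b x)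
    then have ab: "a \<noteq> s \<or> b \<noteq> j"
      using assms by auto
    then have "covered T z [a, b] \<le> covered T p [a, b]"
      using twig le [of "[a, b]"] by (simp add: side_iff)
    with assms(1) show ?thesis
      by (cases rule: broom_point_cases) (use twig ab in \<open>auto split: if_splits\<close>)
  qed
  show "dep z = dep p"
    and "fst z = [a, b] \<Longrightarrow> fst p = [a, b]"
    and "fst z = [a] \<Longrightarrow> fst p = [a] \<or> (\<exists>b. fst p = [a, b])"
    using * by blast+
qed

lemma off_path_exists:
  assumes p: "p \<in> points T" and t: "0 \<le> t" "t < off p"
  shows "\<exists>z. z \<in> path_between T p v \<and> off z = off p - t"
  using p
proof (cases rule: broom_point_cases)
  case root
  then show ?thesis
    using t by simp
next
  case (arm a x)
  then show ?thesis
    using t by (intro exI [of _ "([a], x + t)"]) (auto simp: path_iff side_iff split: if_splits)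
next
  case (twig a b x)
  show ?thesis
  proof (cases "x + t < 1")
    case True
    then show ?thesis
      using twig t
      by (intro exI [of _ "([a, b], x + t)"]) (auto simp: path_iff side_iff split: if_splits)
  next
    case False
    \<comment> \<open>The point has passed the node \<open>[a]\<close> and continues up the arm;
      here \<open>a \<noteq> s\<close>, since inside the subtree \<open>[s]\<close> the spine would
      already be reached.\<close>
    then show ?thesis
      using twig t
      by (intro exI [of _ "([a], x + t - 1)"]) (auto simp: path_iff side_iff split: if_splits)
  qed
qed

text \<open>By \<open>off_path\<close> both points lie on edges determined by \<open>p\<close>.
  Outside the subtree \<open>[s]\<close>, a twig is told apart from its arm by \<open>off\<close>,
  which exceeds \<sigma> on the twig only.\<close>

lemma path_off_eqI:
  assumes p: "p \<in> points T"
    and z: "z \<in> path_between T p v" "0 < off z" and w: "w \<in> path_between T p v" "off w = off z"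
  shows "z = w"
proof -
  have zw: "z \<in> points T" "w \<in> points T"
    using z w by (auto simp: path_between_def)
  have w0: "0 < off w"
    using w z by simp
  from zw(1) show ?thesis
  proof (cases rule: broom_point_cases)
    case root
    then show ?thesis
      using z by simp
  next
    case z_arm: (arm a x)
    then have a: "a \<noteq> s" "off z = \<sigma> - x" "fst p = [a] \<or> (\<exists>b. fst p = [a, b])"
      using z off_path(3) [OF p z, of a] by auto
    from zw(2) show ?thesis
    proof (cases rule: broom_point_cases)
      case root
      then show ?thesis
        using w0 by simp
    next
      case (arm a' y)
      then have "fst p = [a'] \<or> (\<exists>b. fst p = [a', b])"
        using off_path(3) [OF p w(1) w0, of a'] by simp
      then show ?thesis
        using a arm z_arm w(2) by auto
    next
      case (twig a' b y)
      then have "fst p = [a', b]"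
        using off_path(2) [OF p w(1) w0, of a' b] by simp
      then show ?thesis
        using a twig z_arm w(2) by auto
    qed
  next
    case z_twig: (twig a b x)
    then have a: "fst p = [a, b]" "\<not> (a = s \<and> b = j)"
      using z off_path(2) [OF p z, of a b] by auto
    from zw(2) show ?thesis
    proof (cases rule: broom_point_cases)
      case root
      then show ?thesis
        using w0 by simp
    next
      case (arm a' y)
      then have "a' = a" "a' \<noteq> s"
        using off_path(3) [OF p w(1) w0, of a'] a(1) w0 by auto
      then show ?thesis
        using arm z_twig w(2) by simp
    next
      case (twig a' b' y)
      then have "a' = a" "b' = b"
        using off_path(2) [OF p w(1) w0, of a' b'] a(1) by auto
      then show ?thesis
        using a twig z_twig w(2) by (auto split: if_splits)
    qed
  qed
qed

sublocale geodesics_to T v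
proof
  show "v \<in> points T"
    by (rule target_point)
  fix p t
  assume p: "p \<in> points T" and t: "0 \<le> t" "t \<le> path_dist T p v"
  show "\<exists>!q. q \<in> path_between T p v \<and> path_dist T p q = t"
  proof (rule ex_ex1I)
    \<comment> \<open>The motion first uses up \<open>off\<close> at constant \<open>dep\<close>,
      then increases \<open>dep\<close> along the spine.\<close>
    show "\<exists>q. q \<in> path_between T p v \<and> path_dist T p q = t"
    proof (cases "t < off p")
      case True
      from off_path_exists [OF p t(1) this] obtain z
        where "z \<in> path_between T p v" "off z = off p - t"
        by blast
      then show ?thesis
        using dist_on_path [OF p] off_path(1) [OF p] True by (intro exI [of _ z]) simp
    next
      case False
      then have "0 \<le> dep p + t - off p" "dep p + t - off p \<le> \<sigma> + 1"
        using t dist_target [OF p] dep_bounds [OF p] by auto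
      from spine_point_exists [OF this] obtain z
        where z: "z \<in> points T" "off z = 0" "dep z = dep p + t - off p"
        by blast
      then have "z \<in> path_between T p v"
        using spine_path [OF p] False by simp
      then show ?thesis
        using dist_on_path [OF p] z by (intro exI [of _ z]) simp
    qed
  next
    fix z w
    assume "z \<in> path_between T p v \<and> path_dist T p z = t"
      and "w \<in> path_between T p v \<and> path_dist T p w = t"
    then have z: "z \<in> path_between T p v" "off p - off z + dep z - dep p = t"
      and w: "w \<in> path_between T p v" "off p - off w + dep w - dep p = t"
      using dist_on_path [OF p, of z] dist_on_path [OF p, of w] by auto
    have zw: "z \<in> points T" "w \<in> points T"
      using z w by (auto simp: path_between_def)
    have le: "dep p \<le> dep z" "dep p \<le> dep w"
      using z w path_iff [OF p] zw by auto
    show "z = w"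
    proof (cases "off z = 0 \<and> off w = 0")
      case True
      then show ?thesis
        using z w zw by (intro spine_eqI) auto
    next
      case False
      then have "0 < off z \<or> 0 < off w"
        using zw off_nonneg by fastforce
      \<comment> \<open>A point still off the spine has used time
        \<open>t = off p - off z < off p\<close>, whereas reaching the spine takes at least
        \<open>off p\<close>; so both points are off the spine.\<close>
      then have "off w = off z"
        using off_path(1) [OF p z(1)] off_path(1) [OF p w(1)] z w le off_nonneg [OF zw(1)]
          off_nonneg [OF zw(2)] by fastforce
      then show ?thesis
        using path_off_eqI [OF p z(1) _ w(1)] False off_nonneg [OF zw(1)] by auto
    qed
  qed
qed

lemma off_dep_flow:
  assumes p: "p \<in> points T" "0 \<le> t" "t \<le> togo p"
  shows "off (flow t p) = max 0 (off p - t)" "dep (flow t p) = dep p + max 0 (t - off p)"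
proof -
  let ?z = "flow t p"
  note z = flow_in_path [OF p] flow_point [OF p]
  have d: "off p - off ?z + dep ?z - dep p = t" and le: "dep p \<le> dep ?z"
    using dist_on_path [OF p(1) z(1)] z path_iff [OF p(1) z(3)] by auto
  have "off ?z = max 0 (off p - t) \<and> dep ?z = dep p + max 0 (t - off p)"
  proof (cases "0 < off ?z")
    case True
    then show ?thesis
      using off_path(1) [OF p(1) z(1)] d by simp
  next
    case False
    then have "off ?z = 0"
      using off_nonneg [OF z(3)] by simp
    then show ?thesis
      using d le by simp
  qed
  then show "off ?z = max 0 (off p - t)" "dep ?z = dep p + max 0 (t - off p)"
    by blast+
qed

end

section \<open>Double Coverage during a phase\<close>

text \<open>With two servers on one of these edges the rear one could stand still while others move.
  The node \<open>[s]\<close>, represented by \<open>([s], 0)\<close>, falls under neither clause: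
  any number of servers may gather there.\<close>

definition uncrowded :: "nat \<Rightarrow> point multiset \<Rightarrow> bool" where
  "uncrowded s A \<longleftrightarrow>
    size {#p \<in># A. fst p = [s] \<and> 0 < snd p#} \<le> 1 \<and> (\<forall>b. size {#p \<in># A. fst p = [s, b]#} \<le> 1)"

text \<open>The quantity G of the overview.\<close>

definition inflow :: "rtree \<Rightarrow> nat \<Rightarrow> point multiset \<Rightarrow> real" where
  "inflow T s A = (\<Sum>p\<in>#A. covered T p [s])"

lemma sum_mset_nonneg_real:
  "(\<And>x. x \<in># M \<Longrightarrow> 0 \<le> f x) \<Longrightarrow> 0 \<le> (\<Sum>x\<in>#M. f x)" for f :: "'a \<Rightarrow> real"
  by (induction M) auto

lemma size_ge_2:
  assumes "x \<in># M" "y \<in># M" "x \<noteq> y"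
  shows "2 \<le> size M"
proof -
  obtain N where N: "M = add_mset x N"
    using assms(1) by (auto dest: multi_member_split)
  then have "y \<in># N"
    using assms by simp
  then show ?thesis
    using N by (auto dest: multi_member_split)
qed

locale broom_stage = broom_request +
  fixes A A' :: "point multiset" and S :: "point set" and \<delta> :: real
  assumes A: "set_mset A \<subseteq> points T"
    and S: "S = adjacent T v A"
    and \<delta>: "0 < \<delta>"
    and le_togo: "p \<in> S \<Longrightarrow> \<delta> \<le> togo p"
    and steady: "\<lbrakk>0 \<le> t; t < \<delta>\<rbrakk> \<Longrightarrow>
      inj_on (flow t) S \<and> adjacent T v (advance T v S t A) = flow t ` S"
    and A': "A' = advance T v S \<delta> A"
begin

abbreviation rest :: "point multiset" where
  "rest \<equiv> A - mset_set S"

section \<open>Which servers move in a stage\<close>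

lemma finite_S [simp]: "finite S"
  by (simp add: S)

lemma S_in_A: "p \<in> S \<Longrightarrow> p \<in># A"
  by (simp add: S adjacent_def)

lemma S_point: "p \<in> S \<Longrightarrow> p \<in> points T"
  using A S_in_A by blast

lemma rest_in_A: "z \<in># rest \<Longrightarrow> z \<in># A"
  by (rule in_diffD)

lemma in_rest: "z \<in># A \<Longrightarrow> z \<notin> S \<Longrightarrow> z \<in># rest"
  by (metis count_greater_zero_iff count_diff count_mset_set(3) diff_zero)

lemma A_split: "A = rest + mset_set S"
  using mset_set_adjacent by (metis S subset_mset.diff_add)

lemma A'_split: "A' = rest + image_mset (flow \<delta>) (mset_set S)"
  by (simp add: A' advance_def)

lemma off_dep_S:
  assumes "p \<in> S" "0 \<le> t" "t \<le> \<delta>"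
  shows "off (flow t p) = max 0 (off p - t)" "dep (flow t p) = dep p + max 0 (t - off p)"
    "flow t p \<in> points T"
  using off_dep_flow [of p t] flow_point [of p t] assms le_togo [of p] S_point [of p] by auto

text \<open>From time \<open>off p\<close> on, the server from \<open>p\<close> is on the spine;
  being adjacent, it has no other server level with it or beyond it there, except at its own
  point.\<close>

lemma spine_blocks:
  assumes "p \<in> S" "off p \<le> t" "t < \<delta>" "z \<in># advance T v S t A"
    "z \<in> points T" "off z = 0" "dep (flow t p) \<le> dep z"
  shows "z = flow t p"
proof -
  have t: "0 \<le> t"
    using off_nonneg S_point assms by fastforce
  then have "flow t p \<in> adjacent T v (advance T v S t A)"
    using steady [of t] assms by simp
  moreover have "z \<in> path_between T (flow t p) v"
    using off_dep_S [of p t] assms t by (intro spine_path) auto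
  ultimately show ?thesis
    using assms(4) unfolding adjacent_def by blast
qed

lemma S_unique:
  assumes "p \<in> S" "off p < \<delta>" "q \<in> S" "off q < \<delta>"
  shows "p = q"
proof -
  \<comment> \<open>By this time both servers are on the spine, where the deeper one would block the
    other; so they coincide, against injectivity.\<close>
  define t where "t = max (off p) (off q)"
  have t: "off p \<le> t" "off q \<le> t" "t < \<delta>" "0 \<le> t"
    using assms off_nonneg [OF S_point [OF assms(1)]] by (auto simp: t_def)
  have *: "flow t y = flow t x" if "x \<in> {p, q}" "y \<in> {p, q}" "dep (flow t x) \<le> dep (flow t y)" for x y
  proof (rule spine_blocks)
    have y: "y \<in> S" "off y \<le> t"
      using that t assms by auto
    then show "flow t y \<in># advance T v S t A"
      unfolding S by (intro advance_adjacentI)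
    show "flow t y \<in> points T" "off (flow t y) = 0"
      using off_dep_S [of y t] y t by auto
  qed (use that t assms in auto)
  have "flow t p = flow t q"
    using * [of p q] * [of q p] by fastforce
  then show ?thesis
    using steady [of t] t assms by (auto dest: inj_onD)
qed

text \<open>Looks at time \<open>off p\<close>, when the moving server enters the spine at depth
  \<open>dep p\<close>. Equal depth remains possible, as several servers may share a point.\<close>

lemma rest_blocks:
  assumes "p \<in> S" "off p < \<delta>" "z \<in># rest" "off z = 0" "dep p \<le> dep z"
  shows "dep z = dep p"
proof -
  have 0: "0 \<le> off p"
    using off_nonneg S_point assms by blast
  have d: "dep (flow (off p) p) = dep p"
    using off_dep_S(2) [of p "off p"] 0 assms by simp
  have "z \<in> points T"
    using assms(3) rest_in_A A by blast
  then have "z = flow (off p) p"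
    using assms d by (intro spine_blocks) (simp_all add: advance_def)
  then show ?thesis
    using d by simp
qed

lemma size_filter_A: "size (filter_mset P A) = size (filter_mset P rest) + card {p \<in> S. P p}"
proof -
  have "size (filter_mset P A) = size (filter_mset P (rest + mset_set S))"
    using A_split by simp
  then show ?thesis
    by simp
qed

lemma size_filter_A':
  "size (filter_mset P A') = size (filter_mset P rest) + card {p \<in> S. P (flow \<delta> p)}"
  by (simp add: A'_split filter_mset_image_mset)

lemma two_in_filter:
  assumes "p \<in> S" "z \<in># rest" "P p" "P z"
  shows "2 \<le> size (filter_mset P A)"
proof -
  have "{p \<in> S. P p} \<noteq> {}" "finite {p \<in> S. P p}"
    using assms(1,3) by blast (simp add: finite_S)
  then have "0 < card {p \<in> S. P p}"
    by (simp add: card_gt_0_iff)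
  moreover have "z \<in># filter_mset P rest"
    using assms by (simp del: filter_diff_mset)
  then have "0 < size (filter_mset P rest)"
    by (metis nonempty_has_size empty_iff set_mset_empty)
  ultimately show ?thesis
    by (simp add: size_filter_A)
qed

text \<open>A server entering the spine segment described by \<open>P\<close> finds it empty: a server standing there
  would have been blocking it, and at most one moving server is on the spine.\<close>

lemma segment_uncrowded:
  assumes le: "size (filter_mset P A) \<le> 1"
    and P: "\<And>z. z \<in> points T \<Longrightarrow> P z \<longleftrightarrow> lo < dep z \<and> dep z < hi"
    and lo_hi: "0 \<le> lo" "hi \<le> \<sigma> \<or> \<sigma> \<le> lo"
  shows "size (filter_mset P A') \<le> 1"
proof (cases "\<exists>p\<in>S. P (flow \<delta> p) \<and> \<not> P p")
  case False
  then have "card {p \<in> S. P (flow \<delta> p)} \<le> card {p \<in> S. P p}"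
    by (intro card_mono) auto
  then show ?thesis
    using le by (simp add: size_filter_A size_filter_A')
next
  case True
  \<comment> \<open>The open segment avoids the depths 0 and \<sigma>, the only ones at which
    branches leave the spine.\<close>
  have "off z = 0" if "z \<in> points T" "P z" for z
    using dep_off_spine [of z] P [of z] off_nonneg [of z] lo_hi that by fastforce
  note spine = this
  have off: "off q < \<delta>" if "q \<in> S" "P (flow \<delta> q)" for q
  proof (rule ccontr)
    assume "\<not> off q < \<delta>"
    then have "dep (flow \<delta> q) = dep q" "0 < off q" "flow \<delta> q \<in> points T"
      using off_dep_S [of q \<delta>] that \<delta> by auto
    then show False
      using spine [OF S_point] P [of "flow \<delta> q"] P [OF S_point] that by simp
  qed
  from True obtain p where p: "p \<in> S" "P (flow \<delta> p)" "\<not> P p"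
    by blast
  have "dep p \<le> dep (flow \<delta> p)" "flow \<delta> p \<in> points T"
    using off_dep_S [of p \<delta>] p \<delta> by auto
  \<comment> \<open>Depth only grows, so a server that enters the segment started above all of
    it.\<close>
  then have above: "dep p < dep w" if "w \<in> points T" "P w" for w
    using P [of w] P [of "flow \<delta> p"] P [OF S_point] p that by auto
  have "\<not> P z" if "z \<in># rest" for z
  proof
    assume Pz: "P z"
    have z: "z \<in> points T"
      using that rest_in_A A by blast
    show False
      using rest_blocks [OF p(1) off that spine] p above [OF z Pz] z Pz by simp
  qed
  then have "set_mset (filter_mset P rest) = {}"
    by (auto simp del: filter_diff_mset set_mset_eq_empty_iff)
  then have "filter_mset P rest = {#}"
    by (simp only: set_mset_eq_empty_iff)
  moreover have "{q \<in> S. P (flow \<delta> q)} \<subseteq> {p}"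
    using S_unique off p by blast
  then have "card {q \<in> S. P (flow \<delta> q)} \<le> card {p}"
    by (intro card_mono) auto
  ultimately show ?thesis
    by (simp add: size_filter_A')
qed

lemma fst_top: "z \<in> points T \<Longrightarrow> fst z = [s] \<and> 0 < snd z \<longleftrightarrow> 0 < dep z \<and> dep z < \<sigma>"
  by (cases rule: broom_point_cases) (auto split: if_splits)

lemma fst_leaf: "z \<in> points T \<Longrightarrow> fst z = [s, j] \<longleftrightarrow> \<sigma> < dep z"
  by (cases rule: broom_point_cases) (use \<sigma> in \<open>auto split: if_splits\<close>)

lemma uncrowded_A':
  assumes "uncrowded s A"
  shows "uncrowded s A'"
  unfolding uncrowded_def
proof (intro conjI allI)
  show "size {#p \<in># A'. fst p = [s] \<and> 0 < snd p#} \<le> 1"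
    using assms unfolding uncrowded_def
    by (intro segment_uncrowded [where lo = 0 and hi = \<sigma>]) (simp_all add: fst_top)
  fix b
  have le: "size {#p \<in># A. fst p = [s, b]#} \<le> 1"
    using assms by (simp add: uncrowded_def)
  show "size {#p \<in># A'. fst p = [s, b]#} \<le> 1"
  proof (cases "b = j")
    case True
    show ?thesis
      unfolding True
    proof (rule segment_uncrowded [where lo = \<sigma> and hi = "\<sigma> + 2"])
      \<comment> \<open>The leaf itself has depth \<sigma> + 1 and must belong to the segment, so
        \<open>hi\<close> has to be larger than that.\<close>
      show "fst z = [s, j] \<longleftrightarrow> \<sigma> < dep z \<and> dep z < \<sigma> + 2" if "z \<in> points T" for z
        using fst_leaf [OF that] dep_bounds [OF that] by linarith
    qed (use le True \<sigma> in auto)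
  next
    case False
    \<comment> \<open>The other leaf edges are only left, never entered: a server found there is
      still off the spine and has been on that edge from the start.\<close>
    have "fst p = [s, b]" if p: "p \<in> S" "fst (flow \<delta> p) = [s, b]" for p
    proof -
      have "flow \<delta> p \<in> points T"
        using off_dep_S p \<delta> by simp
      then have "0 < off (flow \<delta> p)"
        by (cases rule: broom_point_cases) (use p False in auto)
      moreover have "flow \<delta> p \<in> path_between T p v"
        using flow_in_path(1) [OF S_point] p \<delta> le_togo by simp
      ultimately show ?thesis
        using off_path(2) [OF S_point] p by blast
    qed
    then have "card {p \<in> S. fst (flow \<delta> p) = [s, b]} \<le> card {p \<in> S. fst p = [s, b]}"
      by (intro card_mono) auto
    then show ?thesis
      using le by (simp add: size_filter_A size_filter_A')
  qed
qed

text \<open>While a server moves on the edge above \<open>[s]\<close>, all servers that have already arrived in that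
  subtree move as well.\<close>

lemma rest_not_arrived:
  assumes crowd: "uncrowded s A" and p: "p \<in> S" "off p < \<delta>" "dep p < \<sigma>" and z: "z \<in># rest"
  shows "dep z = 0"
proof (rule ccontr)
  assume "dep z \<noteq> 0"
  have zp: "z \<in> points T"
    using z rest_in_A A by blast
  then have dz: "0 < dep z"
    using dep_bounds [OF zp] \<open>dep z \<noteq> 0\<close> by simp
  have pp: "p \<in> points T"
    using S_point p by blast
  show False
  proof (cases "off z = 0")
    case True
    \<comment> \<open>Being deeper, \<open>z\<close> would block \<open>p\<close>; otherwise both
      are inside the top edge, which has room for one.\<close>
    have "dep z \<le> dep p"
      using rest_blocks [OF p(1,2) z True] by linarith
    then have "fst z = [s] \<and> 0 < snd z" "fst p = [s] \<and> 0 < snd p"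
      unfolding fst_top [OF zp] fst_top [OF pp] using dz p by auto
    then have "2 \<le> size {#p \<in># A. fst p = [s] \<and> 0 < snd p#}"
      by (intro two_in_filter [OF p(1) z])
    then show False
      using crowd by (auto simp: uncrowded_def)
  next
    case False
    have "\<exists>b. fst z = [s, b]"
      using zp by (cases rule: broom_point_cases) (use False dz in \<open>auto split: if_splits\<close>)
    then obtain b where b: "fst z = [s, b]"
      by blast
    have le: "size {#p \<in># A. fst p = [s, b]#} < 2"
      using crowd by (auto simp: uncrowded_def less_Suc_eq_le numeral_2_eq_2)
    have dz: "dep z = \<sigma>"
      using zp by (cases rule: broom_point_cases) (use b False in auto)
    \<comment> \<open>Something blocks \<open>z\<close>: on the spine it would be deeper than
      \<open>p\<close> and block \<open>p\<close> as well, and off the spine it would share the leaf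
      edge of \<open>z\<close>.\<close>
    have "z \<notin> S"
      using two_in_filter [OF _ z, of z "\<lambda>p. fst p = [s, b]"] b le by auto
    then obtain w where w: "w \<in># A" "w \<in> path_between T z v" "w \<noteq> z"
      using rest_in_A [OF z] path_refl [OF zp] unfolding S adjacent_def by blast
    have wp: "w \<in> points T"
      using w A by blast
    show False
    proof (cases "off w = 0")
      case True
      have dw: "dep p < dep w"
        using path_iff [OF zp wp] w dz p by auto
      then have "w \<notin> S"
        using S_unique [OF p(1,2), of w] True \<delta> by auto
      then show False
        using rest_blocks [OF p(1,2) in_rest True] w dw by simp
    next
      case False
      then have ow: "0 < off w"
        using off_nonneg [OF wp] by simp
      note o = off_path(2,3) [OF zp w(2) ow]
      have "fst w = [s, b]"
        using wp by (cases rule: broom_point_cases) (use o b False in auto)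
      then have "2 \<le> size {#p \<in># A. fst p = [s, b]#}"
        using w rest_in_A [OF z] b by (intro size_ge_2 [of w _ z]) auto
      then show False
        using le by simp
    qed
  qed
qed

section \<open>Growth of the inflow\<close>

lemma inflow_A': "inflow T s A' = (\<Sum>z\<in>#rest. covered T z [s]) + (\<Sum>p\<in>S. covered T (flow \<delta> p) [s])"
  by (simp add: inflow_def A'_split sum_unfold_sum_mset image_mset.compositionality comp_def)

lemma inflow_A: "inflow T s A = (\<Sum>z\<in>#rest. covered T z [s]) + (\<Sum>p\<in>S. covered T p [s])"
proof -
  have "inflow T s A = inflow T s (rest + mset_set S)"
    using A_split by simp
  then show ?thesis
    by (simp add: inflow_def sum_unfold_sum_mset)
qed

lemma covered_top_S:
  assumes "p \<in> S"
  shows "covered T (flow \<delta> p) [s] = min (dep p + max 0 (\<delta> - off p)) \<sigma>"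
    "covered T p [s] = min (dep p) \<sigma>"
  using off_dep_S [OF assms, of \<delta>] covered_spine(1) [OF S_point [OF assms]] \<delta>
  by (simp_all add: covered_spine(1))

text \<open>At most one moving server increases its share of the top edge, and by at most \<delta>.
  If one does, resting servers contribute 0, so the inflow is at most
  \<open>card S * \<sigma>\<close> afterwards. Factoring the difference of squares gives \<delta>
  times twice that bound.\<close>

lemma inflow_growth:
  assumes crowd: "uncrowded s A"
  shows "(inflow T s A')\<^sup>2 - (inflow T s A)\<^sup>2 \<le> 2 * \<sigma> * (real (card S) * \<delta>)"
proof (cases "\<exists>p\<in>S. covered T p [s] < covered T (flow \<delta> p) [s]")
  case False
  have "covered T (flow \<delta> p) [s] \<le> covered T p [s]" if "p \<in> S" for p
    using False that by force
  moreover have "covered T p [s] \<le> covered T (flow \<delta> p) [s]" if "p \<in> S" for p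
    using covered_top_S [OF that] by simp
  ultimately have "inflow T s A' = inflow T s A"
    unfolding inflow_A inflow_A' by (intro arg_cong2 [where f = "(+)"] sum.cong) (auto intro: order_antisym)
  then show ?thesis
    using \<sigma> \<delta> by simp
next
  case True
  have new: "off q < \<delta> \<and> dep q < \<sigma>" if "q \<in> S" "covered T q [s] < covered T (flow \<delta> q) [s]" for q
    using that(2) covered_top_S [OF that(1)] by (auto simp: min_def max_def split: if_splits)
  from True obtain p where p: "p \<in> S" "covered T p [s] < covered T (flow \<delta> p) [s]"
    by blast
  have same: "covered T (flow \<delta> q) [s] = covered T q [s]" if "q \<in> S - {p}" for q
  proof -
    have "\<not> covered T q [s] < covered T (flow \<delta> q) [s]"
      using new [of q] new [of p] S_unique [of p q] p that by blast
    moreover have "covered T q [s] \<le> covered T (flow \<delta> q) [s]"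
      using covered_top_S [of q] that by simp
    ultimately show ?thesis
      by simp
  qed
  have diff: "inflow T s A' - inflow T s A = covered T (flow \<delta> p) [s] - covered T p [s]"
  proof -
    have "(\<Sum>q\<in>S. covered T (flow \<delta> q) [s]) =
        covered T (flow \<delta> p) [s] + (\<Sum>q\<in>S - {p}. covered T q [s])"
      using same p by (simp add: sum.remove [of S p])
    moreover have "(\<Sum>q\<in>S. covered T q [s]) = covered T p [s] + (\<Sum>q\<in>S - {p}. covered T q [s])"
      using p by (simp add: sum.remove)
    ultimately show ?thesis
      unfolding inflow_A inflow_A' by simp
  qed
  have "covered T (flow \<delta> p) [s] - covered T p [s] \<le> \<delta>"
    using covered_top_S [OF p(1)] off_nonneg [OF S_point [OF p(1)]] \<delta>
    by (auto simp: min_def max_def split: if_splits)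
  then have growth: "0 \<le> inflow T s A' - inflow T s A" "inflow T s A' - inflow T s A \<le> \<delta>"
    using diff p by auto
  have "covered T z [s] = 0" if "z \<in># rest" for z
  proof -
    have "z \<in> points T"
      using that rest_in_A A by blast
    then show ?thesis
      using rest_not_arrived [OF crowd p(1) _ _ that] new [OF p] covered_spine(1) \<sigma> by simp
  qed
  then have "(\<Sum>z\<in>#rest. covered T z [s]) = (\<Sum>z\<in>#rest. 0)"
    by (intro arg_cong [where f = sum_mset] image_mset_cong)
  then have "inflow T s A' = (\<Sum>q\<in>S. covered T (flow \<delta> q) [s])"
    by (simp add: inflow_A')
  also have "\<dots> \<le> of_nat (card S) * \<sigma>"
    by (intro sum_bounded_above) (simp add: covered_top_S)
  finally have upper: "inflow T s A' \<le> real (card S) * \<sigma>" .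
  have "covered T z [s] \<ge> 0" if "z \<in># A" for z
  proof -
    have "z \<in> points T"
      using that A by blast
    then show ?thesis
      using covered_spine(1) dep_bounds \<sigma> by simp
  qed
  then have nonneg: "0 \<le> inflow T s A"
    unfolding inflow_def by (rule sum_mset_nonneg_real)
  have "(inflow T s A')\<^sup>2 - (inflow T s A)\<^sup>2 =
      (inflow T s A' - inflow T s A) * (inflow T s A' + inflow T s A)"
    by (simp add: power2_eq_square algebra_simps)
  also have "\<dots> \<le> \<delta> * (2 * (real (card S) * \<sigma>))"
    using growth upper nonneg by (intro mult_mono) auto
  finally show ?thesis
    by (simp add: algebra_simps)
qed

text \<open>A server on the edge of the requested leaf blocks every server outside this edge, so
  nobody leaves another leaf.\<close>

lemma leaf_edge_occupied:
  assumes "z \<in># A" "\<sigma> < dep z"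
  shows "\<exists>z. z \<in># A' \<and> \<sigma> < dep z" "b \<noteq> j \<Longrightarrow> ([s, b], 0) \<in># A \<Longrightarrow> ([s, b], 0) \<in># A'"
proof -
  have zp: "z \<in> points T"
    using assms A by blast
  have deep: "\<sigma> < dep q" if "q \<in> S" for q
  proof (rule ccontr)
    assume q: "\<not> \<sigma> < dep q"
    have "off z = 0"
      using dep_off_spine [OF zp] off_nonneg [OF zp] assms \<sigma> by fastforce
    then have "z \<in> path_between T q v"
      using spine_path S_point that zp q assms by simp
    then have "z = q"
      using that assms(1) unfolding S adjacent_def by blast
    then show False
      using q assms by simp
  qed
  obtain q where q: "q \<in> S"
    using adjacent_on_path [OF A assms(1)] S by blast
  have "flow \<delta> q \<in># A'"
    using q unfolding A' S by (rule advance_adjacentI)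
  moreover have "\<sigma> < dep (flow \<delta> q)"
    using off_dep_S [of q \<delta>] q deep [OF q] \<delta> by simp
  ultimately show "\<exists>z. z \<in># A' \<and> \<sigma> < dep z"
    by blast
  assume b: "b \<noteq> j" "([s, b], 0) \<in># A"
  then have "([s, b], 0) \<notin> S"
    using deep by fastforce
  then show "([s, b], 0) \<in># A'"
    using in_rest [OF b(2)] by (simp add: A'_split)
qed

end

section \<open>From stages to whole requests\<close>

context broom_request
begin

lemma stageI:
  assumes "set_mset A \<subseteq> points T" "S = adjacent T v A" "0 < \<delta>" "\<And>p. p \<in> S \<Longrightarrow> \<delta> \<le> togo p"
    "\<And>t. 0 \<le> t \<Longrightarrow> t < \<delta> \<Longrightarrow> inj_on (flow t) S \<and> adjacent T v (advance T v S t A) = flow t ` S"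
    "A' = advance T v S \<delta> A"
  shows "broom_stage \<sigma> m h s j A A' S \<delta>"
  using assms by unfold_locales auto

lemma serve_inflow:
  assumes "dc_serve T v A B c" "set_mset A \<subseteq> points T" "uncrowded s A"
  shows "uncrowded s B \<and> (inflow T s B)\<^sup>2 - (inflow T s A)\<^sup>2 \<le> 2 * \<sigma> * c"
  using assms
proof (induction rule: dc_serve_induct)
  case (stage A A' S \<delta> B c)
  interpret broom_stage \<sigma> m h s j A A' S \<delta>
    using stage.hyps by (intro stageI)
  show ?case
    using stage.IH [OF uncrowded_A' [OF stage.prems]] inflow_growth [OF stage.prems]
    by (simp add: algebra_simps)
qed simp

lemma serve_keeps_leaves:
  assumes "dc_serve T v A B c" "set_mset A \<subseteq> points T" "\<exists>z. z \<in># A \<and> \<sigma> < dep z"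
    "b \<noteq> j" "([s, b], 0) \<in># A"
  shows "([s, b], 0) \<in># B"
  using assms
proof (induction rule: dc_serve_induct)
  case (stage A A' S \<delta> B c)
  interpret broom_stage \<sigma> m h s j A A' S \<delta>
    using stage.hyps by (intro stageI)
  show ?case
    using stage.IH stage.prems leaf_edge_occupied by blast
qed simp

text \<open>Leaf edges have length 1, so a server at distance less than 1 from the requested leaf is
  already on its edge.\<close>

lemma cheap_serve_keeps_leaves:
  assumes "dc_serve T v A B c" "set_mset A \<subseteq> points T" "A \<noteq> {#}" "c < 1" "([s, b], 0) \<in># A"
  shows "([s, b], 0) \<in># B"
proof (cases "b = j")
  case True
  then show ?thesis
    using dc_serve_config [OF assms(1,2)] by simp
next
  case False
  obtain p where p: "p \<in># A" "togo p < 1"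
    using dc_serve_cost_ge [OF assms(1-3)] assms(4) by fastforce
  then have "p \<in> points T"
    using assms by blast
  then have "\<sigma> < dep p"
    using p dist_target [of p] off_nonneg [of p] by simp
  then show ?thesis
    using serve_keeps_leaves [OF assms(1,2)] p False assms(5) by blast
qed

end

section \<open>One phase\<close>

definition served_leaves :: "nat \<Rightarrow> nat \<Rightarrow> point multiset \<Rightarrow> nat set" where
  "served_leaves h s A = {b. b < h \<and> ([s, b], 0) \<in># A}"

lemma served_leaves_subset: "served_leaves h s A \<subseteq> {..<h}"
  by (auto simp: served_leaves_def)

lemma finite_served_leaves [simp]: "finite (served_leaves h s A)"
  by (rule finite_subset [OF served_leaves_subset]) simp

lemma card_served_leaves: "card (served_leaves h s A) \<le> h"
  using card_mono [OF _ served_leaves_subset [of h s A]] by simp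

text \<open>A request of cost less than 1 is served by a server on the edge of the requested leaf, hence
  uncovers no other leaf. This rules out infinitely many requests of bounded total cost.\<close>

lemma request_progress:
  fixes c :: real
  assumes "0 < \<sigma>" "s < m" "j < h" "set_mset A \<subseteq> points (broom \<sigma> m h)" "A \<noteq> {#}"
    and new: "j \<notin> served_leaves h s A"
    and B: "dc_serve (broom \<sigma> m h) ([s, j], 0) A B c"
  shows "1 + real (card (served_leaves h s A)) \<le> card (served_leaves h s B) + h * c"
proof -
  interpret broom_request \<sigma> m h s j
    using assms by unfold_locales auto
  have c: "0 \<le> c" and jB: "j \<in> served_leaves h s B"
    using dc_serve_config [OF B assms(4)] assms(3) by (auto simp: served_leaves_def)
  show ?thesis
  proof (cases "c < 1")
    case True
    then have "insert j (served_leaves h s A) \<subseteq> served_leaves h s B"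
      using cheap_serve_keeps_leaves [OF B assms(4,5)] jB by (auto simp: served_leaves_def)
    then have "card (insert j (served_leaves h s A)) \<le> card (served_leaves h s B)"
      by (intro card_mono) auto
    then have "1 + real (card (served_leaves h s A)) \<le> card (served_leaves h s B)"
      using new by simp
    then show ?thesis
      using c by (simp add: add_increasing2)
  next
    case False
    \<comment> \<open>An expensive request may uncover all other leaves. The term
      \<open>h * c \<ge> h\<close> pays for them, and the leaf \<open>j\<close> itself provides the
      1.\<close>
    have "1 \<le> card (served_leaves h s B)"
      using jB by (auto simp: Suc_le_eq card_gt_0_iff)
    moreover have "real (card (served_leaves h s A)) \<le> h"
      using card_served_leaves by simp
    moreover have "real h * 1 \<le> h * c"
      using False by (intro mult_left_mono) auto
    ultimately show ?thesis
      by simp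
  qed
qed

text \<open>The number of covered leaves plus \<open>h\<close> times the cost grows by at least 1
  per request, and at most \<open>h\<close> leaves can be covered; so a long phase without full
  coverage is expensive. The arbitrary continuation \<open>J\<close> lets phases be chained.\<close>

lemma phase_progress:
  fixes n :: nat
  assumes "0 < \<sigma>" "s < m" "set_mset A \<subseteq> points (broom \<sigma> m h)" "A \<noteq> {#}" "uncrowded s A"
  shows "\<exists>I B. \<exists>c::real. set I \<subseteq> (\<lambda>b. ([s, b], 0)) ` {..<h} \<and>
    (\<forall>J d. dc_run (broom \<sigma> m h) B J d \<longrightarrow> dc_run (broom \<sigma> m h) A (I @ J) (c + d)) \<and>
    set_mset B \<subseteq> points (broom \<sigma> m h) \<and> size B = size A \<and>
    (inflow (broom \<sigma> m h) s B)\<^sup>2 - (inflow (broom \<sigma> m h) s A)\<^sup>2 \<le> 2 * \<sigma> * c \<and>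
    (served_leaves h s B = {..<h} \<or>
      n + real (card (served_leaves h s A)) \<le> card (served_leaves h s B) + h * c)"
  using assms(3-)
proof (induction n arbitrary: A)
  case 0
  then show ?case
    by (intro exI [of _ "[]"] exI [of _ A] exI [of _ 0]) auto
next
  case (Suc n)
  let ?T = "broom \<sigma> m h"
  show ?case
  proof (cases "served_leaves h s A = {..<h}")
    case True
    then show ?thesis
      using Suc.prems by (intro exI [of _ "[]"] exI [of _ A] exI [of _ 0]) auto
  next
    case False
    then obtain j where new: "j < h" "j \<notin> served_leaves h s A"
      using served_leaves_subset by blast
    interpret broom_request \<sigma> m h s j
      using assms new by unfold_locales auto
    obtain B c where B: "dc_serve ?T ([s, j], 0) A B c"
      using dc_serve_exists Suc.prems by blast
    note conf = dc_serve_config [OF B Suc.prems(1)]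
    note infl = serve_inflow [OF B Suc.prems(1,3)]
    have "([s, j], 0) \<in># B"
      using conf by (elim conjE)
    then have "B \<noteq> {#}"
      by (rule contrapos_pn) simp
    from Suc.IH [OF conjunct1 [OF conf] this conjunct1 [OF infl]] obtain I B' and c' :: real where I:
      "set I \<subseteq> (\<lambda>b. ([s, b], 0)) ` {..<h}"
      "\<forall>J d. dc_run ?T B' J d \<longrightarrow> dc_run ?T B (I @ J) (c' + d)"
      "set_mset B' \<subseteq> points ?T" "size B' = size B"
      "(inflow ?T s B')\<^sup>2 - (inflow ?T s B)\<^sup>2 \<le> 2 * \<sigma> * c'"
      "served_leaves h s B' = {..<h} \<or>
        n + real (card (served_leaves h s B)) \<le> card (served_leaves h s B') + h * c'"
      by blast
    have run: "dc_run ?T A ((([s, j], 0) # I) @ J) (c + c' + d)" if "dc_run ?T B' J d" for J d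
      using dc_run.Cons [OF B I(2) [rule_format, OF that]] by (simp add: add.assoc)
    have "1 + real (card (served_leaves h s A)) \<le> card (served_leaves h s B) + h * c"
      using assms(1,2) new Suc.prems(1,2) B by (intro request_progress)
    then have progress: "served_leaves h s B' = {..<h} \<or>
        Suc n + real (card (served_leaves h s A)) \<le> card (served_leaves h s B') + h * (c + c')"
      using I(6) by (auto simp: algebra_simps)
    have "(inflow ?T s B')\<^sup>2 - (inflow ?T s A)\<^sup>2 \<le> 2 * \<sigma> * (c + c')"
      using I(5) conjunct2 [OF infl] by (simp add: distrib_left)
    moreover have "size B' = size A"
      using I(4) conf by (elim conjE) simp
    moreover have "set (([s, j], 0) # I) \<subseteq> (\<lambda>b. ([s, b], 0)) ` {..<h}"
      using I(1) new(1) by simp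
    ultimately show ?thesis
      using I(3) run progress by (intro exI conjI allI impI)
  qed
qed

lemma inflow_served:
  assumes "0 < \<sigma>" "s < m" "set_mset B \<subseteq> points (broom \<sigma> m h)" "served_leaves h s B = {..<h}"
  shows "h * \<sigma> \<le> inflow (broom \<sigma> m h) s B"
proof -
  let ?X = "mset_set ((\<lambda>b. ([s, b], 0 :: real)) ` {..<h})"
  have inj: "inj_on (\<lambda>b. ([s, b], 0 :: real)) {..<h}"
    by (auto intro: inj_onI)
  have "(\<lambda>b. ([s, b], 0)) ` {..<h} \<subseteq> set_mset B"
    using assms(4) by (auto simp: served_leaves_def)
  then have "?X \<subseteq># mset_set (set_mset B)"
    by (intro subset_imp_msubset_mset_set) auto
  then have "?X \<subseteq># B"
    using mset_set_set_mset_msubset subset_mset.order_trans by blast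
  then obtain R where R: "B = ?X + R"
    by (auto simp: mset_subset_eq_exists_conv)
  have "0 \<le> (\<Sum>p\<in>#R. covered (broom \<sigma> m h) p [s])"
  proof (rule sum_mset_nonneg_real)
    fix p
    assume "p \<in># R"
    then have "p \<in> points (broom \<sigma> m h)"
      using R assms(3) by (metis subsetD union_iff)
    then show "0 \<le> covered (broom \<sigma> m h) p [s]"
      using assms by (intro covered_broom_nonneg) (auto simp: edges_broom)
  qed
  moreover have "(\<Sum>p\<in>#?X. covered (broom \<sigma> m h) p [s]) = h * \<sigma>"
    by (simp add: sum_unfold_sum_mset [symmetric] sum.reindex [OF inj])
  ultimately show ?thesis
    unfolding inflow_def by (subst R) simp
qed

lemma phase:
  assumes "0 < \<sigma>" "set_mset A \<subseteq> points (broom \<sigma> m h)" "A \<noteq> {#}" "size A < m" "0 < h"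
  shows "\<exists>s<m. \<exists>I B. \<exists>c::real. set I \<subseteq> (\<lambda>b. ([s, b], 0)) ` {..<h} \<and>
    (\<forall>J d. dc_run (broom \<sigma> m h) B J d \<longrightarrow> dc_run (broom \<sigma> m h) A (I @ J) (c + d)) \<and>
    set_mset B \<subseteq> points (broom \<sigma> m h) \<and> size B = size A \<and> (real h)\<^sup>2 * \<sigma> / 2 \<le> c"
proof -
  let ?T = "broom \<sigma> m h" and ?K = "(real h)\<^sup>2 * \<sigma> / 2"
  \<comment> \<open>Pigeonhole over arm indices. The unspecified value \<open>hd []\<close> for
    servers at the root is harmless, since the image still has fewer than \<open>m\<close>
    elements.\<close>
  have "card ((\<lambda>p. hd (fst p)) ` set_mset A) < card {..<m}"
    using card_image_le [of "set_mset A" "\<lambda>p. hd (fst p)"] assms(4)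
      size_mset_mono [OF mset_set_set_mset_msubset [of A]] by simp
  then obtain s where s: "s < m" "s \<notin> (\<lambda>p. hd (fst p)) ` set_mset A"
    by (metis card_mono finite_imageI finite_set_mset lessThan_iff not_less subsetI)
  then have fresh: "fst p \<noteq> s # u" if "p \<in># A" for p u
    using that by force
  have "{#p \<in># A. fst p = [s] \<and> 0 < snd p#} = {#}"
    using fresh by (simp add: filter_mset_eq_conv)
  moreover have "{#p \<in># A. fst p = [s, b]#} = {#}" for b
    using fresh by (simp add: filter_mset_eq_conv)
  ultimately have crowd: "uncrowded s A"
    unfolding uncrowded_def by (simp only: size_empty) simp
  have "covered ?T p [s] = 0" if "p \<in># A" for p
    using subsetD [OF assms(2) that] fresh [OF that] by (cases rule: broom_point_cases) auto
  then have A0: "inflow ?T s A = 0"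
    by (simp add: inflow_def cong: image_mset_cong)
  \<comment> \<open>Without full coverage the cost is at least \<open>(n - h) / h\<close>; this
    \<open>n\<close> makes it at least \<open>?K\<close>.\<close>
  define n where "n = nat \<lceil>h + h * ?K\<rceil>"
  have n: "h + h * ?K \<le> n"
    by (simp add: n_def of_nat_ceiling)
  from phase_progress [OF assms(1) s(1) assms(2,3) crowd, of n] obtain I B and c :: real where I:
    "set I \<subseteq> (\<lambda>b. ([s, b], 0)) ` {..<h}"
    "\<forall>J d. dc_run ?T B J d \<longrightarrow> dc_run ?T A (I @ J) (c + d)"
    "set_mset B \<subseteq> points ?T" "size B = size A"
    "(inflow ?T s B)\<^sup>2 - (inflow ?T s A)\<^sup>2 \<le> 2 * \<sigma> * c"
    "served_leaves h s B = {..<h} \<or>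
      n + real (card (served_leaves h s A)) \<le> card (served_leaves h s B) + h * c"
    by blast
  have "?K \<le> c"
    using I(6)
  proof
    assume "served_leaves h s B = {..<h}"
    then have "h * \<sigma> \<le> inflow ?T s B"
      using inflow_served assms s I by blast
    then have "(h * \<sigma>)\<^sup>2 \<le> (inflow ?T s B)\<^sup>2"
      using assms by (intro power_mono) auto
    then have "(2 * \<sigma>) * ?K \<le> (2 * \<sigma>) * c"
      using I(5) A0 by (simp add: power2_eq_square algebra_simps)
    then show ?thesis
      using assms(1) by simp
  next
    assume "n + real (card (served_leaves h s A)) \<le> card (served_leaves h s B) + h * c"
    then have "h + h * ?K \<le> h + h * c"
      using n card_served_leaves [of h s B] by linarith
    then show ?thesis
      using assms(5) by simp
  qed
  then show ?thesis
    using I s(1) by blast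
qed

section \<open>The offline schedule\<close>

text \<open>Fixes the start as an assignment \<open>X\<^sub>0\<close> instead of a multiset, so that
  schedules of consecutive phases can be joined server by server.\<close>

definition affordable ::
  "rtree \<Rightarrow> nat \<Rightarrow> (nat \<Rightarrow> point) \<Rightarrow> point list \<Rightarrow> real \<Rightarrow> bool" where
  "affordable T h X\<^sub>0 I w \<longleftrightarrow> (\<exists>X. X 0 = X\<^sub>0 \<and>
     (\<forall>j\<le>length I. \<forall>i<h. X j i \<in> points T) \<and>
     (\<forall>j<length I. \<exists>i<h. X (Suc j) i = I ! j) \<and>
     schedule_cost T h (length I) X \<le> w)"

lemma affordable_mono: "affordable T h X\<^sub>0 I w \<Longrightarrow> w \<le> w' \<Longrightarrow> affordable T h X\<^sub>0 I w'"
  unfolding affordable_def by (blast intro: order_trans)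

lemma affordable_Nil: "(\<forall>i<h. X\<^sub>0 i \<in> points T) \<Longrightarrow> affordable T h X\<^sub>0 [] 0"
  unfolding affordable_def by (intro exI [of _ "\<lambda>_. X\<^sub>0"]) (simp add: schedule_cost_def)

lemma affordable_Cons:
  assumes "affordable T h Y I w" "\<forall>i<h. X\<^sub>0 i \<in> points T" "\<exists>i<h. Y i = v"
  shows "affordable T h X\<^sub>0 (v # I) ((\<Sum>i<h. path_dist T (X\<^sub>0 i) (Y i)) + w)"
proof -
  obtain X where X: "X 0 = Y" "\<forall>j\<le>length I. \<forall>i<h. X j i \<in> points T"
    "\<forall>j<length I. \<exists>i<h. X (Suc j) i = I ! j" "schedule_cost T h (length I) X \<le> w"
    using assms(1) by (auto simp: affordable_def)
  let ?X = "case_nat X\<^sub>0 X"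
  have "schedule_cost T h (length (v # I)) ?X =
      (\<Sum>i<h. path_dist T (X\<^sub>0 i) (Y i)) + schedule_cost T h (length I) X"
    using X(1) by (simp add: schedule_cost_def sum.lessThan_Suc_shift del: sum.lessThan_Suc)
  then show ?thesis
    using X assms unfolding affordable_def
    by (intro exI [of _ ?X]) (auto simp: nth_Cons split: nat.split)
qed

lemma affordable_stay:
  assumes "s < m" "set I \<subseteq> (\<lambda>b. ([s, b], 0)) ` {..<h}" "affordable (broom \<sigma> m h) h (\<lambda>i. ([s, i], 0)) J w"
  shows "affordable (broom \<sigma> m h) h (\<lambda>i. ([s, i], 0)) (I @ J) w"
  using assms(2)
proof (induction I)
  case Nil
  then show ?case
    using assms by simp
next
  case (Cons u I)
  then have "affordable (broom \<sigma> m h) h (\<lambda>i. ([s, i], 0)) (u # I @ J)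
      ((\<Sum>i<h. path_dist (broom \<sigma> m h) ([s, i], 0) ([s, i], 0)) + w)"
    using assms(1) by (intro affordable_Cons) auto
  then show ?case
    by simp
qed

text \<open>All servers jump to the leaves at the first request, and the rest of the phase is free.
  If \<open>I\<close> is empty there is no step in which to jump, so \<open>J\<close> is assumed
  affordable from every start.\<close>

lemma affordable_phase:
  assumes "0 < \<sigma>" "s < m" "set I \<subseteq> (\<lambda>b. ([s, b], 0)) ` {..<h}"
    and J: "\<And>Y. (\<forall>i<h. Y i \<in> points (broom \<sigma> m h)) \<Longrightarrow> affordable (broom \<sigma> m h) h Y J w"
    and X: "\<forall>i<h. X\<^sub>0 i \<in> points (broom \<sigma> m h)"
  shows "affordable (broom \<sigma> m h) h X\<^sub>0 (I @ J) (h * (2 * (\<sigma> + 1)) + w)"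
proof (cases I)
  case Nil
  then show ?thesis
    using affordable_mono [OF J [OF X]] assms(1) by simp
next
  case (Cons u I')
  let ?T = "broom \<sigma> m h"
  have "affordable ?T h (\<lambda>i. ([s, i], 0)) J w"
    using J assms(2) by simp
  then have "affordable ?T h (\<lambda>i. ([s, i], 0)) (I' @ J) w"
    using affordable_stay assms Cons by simp
  then have "affordable ?T h X\<^sub>0 (u # I' @ J)
      ((\<Sum>i<h. path_dist ?T (X\<^sub>0 i) ([s, i], 0)) + w)"
    using X assms(3) Cons by (intro affordable_Cons) auto
  moreover have "(\<Sum>i<h. path_dist ?T (X\<^sub>0 i) ([s, i], 0)) \<le> of_nat (card {..<h}) * (2 * (\<sigma> + 1))"
    using X assms by (intro sum_bounded_above path_dist_broom_le) auto
  ultimately show ?thesis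
    using Cons by (auto elim!: affordable_mono)
qed

section \<open>Optimum and repetition of phases\<close>

lemma schedule_cost_nonneg: "0 \<le> schedule_cost T h n X"
  by (simp add: schedule_cost_def sum_nonneg path_dist_nonneg)

lemma opt_cost_bounds:
  assumes "affordable T (size B) X\<^sub>0 I w" "image_mset X\<^sub>0 (mset_set {..<size B}) = B"
  shows "0 \<le> opt_cost T B I" "opt_cost T B I \<le> w"
proof -
  let ?C = "{schedule_cost T (size B) (length I) X | X. offline_schedule T B I X}"
  obtain X where X: "offline_schedule T B I X" "schedule_cost T (size B) (length I) X \<le> w"
    using assms by (auto simp: affordable_def offline_schedule_def)
  then have mem: "schedule_cost T (size B) (length I) X \<in> ?C"
    by blast
  show "0 \<le> opt_cost T B I"
    unfolding opt_cost_def using mem by (intro cInf_greatest) (auto simp: schedule_cost_nonneg)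
  have "bdd_below ?C"
    by (intro bdd_belowI [of _ 0]) (auto simp: schedule_cost_nonneg)
  then have "opt_cost T B I \<le> schedule_cost T (size B) (length I) X"
    unfolding opt_cost_def using mem by (intro cInf_lower)
  then show "opt_cost T B I \<le> w"
    using X by simp
qed

text \<open>The offline bound is uniform in the start \<open>X\<^sub>0\<close>, so it does not
  depend on where the previous phase ended.\<close>

lemma phases:
  assumes "0 < \<sigma>" "0 < h" "set_mset A \<subseteq> points (broom \<sigma> m h)" "A \<noteq> {#}" "size A < m"
  shows "\<exists>I. \<exists>c::real. set I \<subseteq> leaf_points (broom \<sigma> m h) \<and> dc_run (broom \<sigma> m h) A I c \<and>
    N * ((real h)\<^sup>2 * \<sigma> / 2) \<le> c \<and>
    (\<forall>X\<^sub>0. (\<forall>i<h. X\<^sub>0 i \<in> points (broom \<sigma> m h)) \<longrightarrow>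
      affordable (broom \<sigma> m h) h X\<^sub>0 I (real N * (h * (2 * (\<sigma> + 1)))))"
  using assms(3-)
proof (induction N arbitrary: A)
  case 0
  then show ?case
    by (intro exI [of _ "[]"] exI [of _ 0]) (auto intro: dc_run.Nil affordable_Nil)
next
  case (Suc N)
  let ?T = "broom \<sigma> m h"
  from phase [OF assms(1) Suc.prems assms(2)] obtain s I B and c :: real where I:
    "s < m" "set I \<subseteq> (\<lambda>b. ([s, b], 0)) ` {..<h}"
    "\<And>J d. dc_run ?T B J d \<Longrightarrow> dc_run ?T A (I @ J) (c + d)"
    "set_mset B \<subseteq> points ?T" "size B = size A" "(real h)\<^sup>2 * \<sigma> / 2 \<le> c"
    by blast
  have "B \<noteq> {#}" "size B < m"
    using I(5) Suc.prems(2,3) by auto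
  from Suc.IH [OF I(4) this] obtain J d where J:
    "set J \<subseteq> leaf_points ?T" "dc_run ?T B J d" "N * ((real h)\<^sup>2 * \<sigma> / 2) \<le> d"
    "\<And>Y. (\<forall>i<h. Y i \<in> points ?T) \<Longrightarrow> affordable ?T h Y J (real N * (h * (2 * (\<sigma> + 1))))"
    by blast
  have "0 < m"
    using I(1) by simp
  then have "(\<lambda>b. ([s, b], 0)) ` {..<h} \<subseteq> leaf_points ?T"
    using I(1) by (auto simp: leaf_points_def leaves_broom [OF _ assms(2)] image_iff)
  then have "set I \<subseteq> leaf_points ?T"
    using I(2) by blast
  then have leaf: "set (I @ J) \<subseteq> leaf_points ?T"
    using J(1) by simp
  have Suc_mult: "real (Suc N) * x = x + real N * x" for x
    by (simp add: distrib_right)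
  have offline: "affordable ?T h X\<^sub>0 (I @ J) (real (Suc N) * (h * (2 * (\<sigma> + 1))))"
    if "\<forall>i<h. X\<^sub>0 i \<in> points ?T" for X\<^sub>0
    unfolding Suc_mult by (rule affordable_phase [OF assms(1) I(1,2) J(4) that])
  have online: "real (Suc N) * ((real h)\<^sup>2 * \<sigma> / 2) \<le> c + d"
    unfolding Suc_mult using I(6) J(3) by (rule add_mono)
  show ?case
    by (intro exI conjI allI impI) (rule leaf, rule I(3) [OF J(2)], rule online, rule offline)
qed

theorem theorem1:
  "\<exists>c::real. c > 0 \<and>
     (\<forall>\<sigma>::real. \<sigma> > 1 \<longrightarrow>
       (\<forall>h k :: nat. 1 \<le> h \<and> h \<le> k \<longrightarrow>
         (\<exists>T. depth_hst \<sigma> 2 T \<and>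
           (\<forall>A\<in>configs T k. \<forall>B\<in>configs T h. \<forall>R::real.
              R < c * real h \<longrightarrow> \<not> dc_competitive T A B R))))"
proof (intro exI [of _ "1 / 8"] conjI allI impI)
  show "(0::real) < 1 / 8"
    by simp
  fix \<sigma> :: real and h k :: nat
  assume \<sigma>: "1 < \<sigma>" and hk: "1 \<le> h \<and> h \<le> k"
  define T where "T = broom \<sigma> (Suc k) h"
  have "\<not> dc_competitive T A B R"
    if A: "A \<in> configs T k" and B: "B \<in> configs T h" and R: "R < 1 / 8 * real h" for A B R
  proof
    assume "dc_competitive T A B R"
    then obtain \<alpha> where \<alpha>:
      "\<And>I c. set I \<subseteq> leaf_points T \<Longrightarrow> dc_run T A I c \<Longrightarrow> c \<le> R * opt_cost T B I + \<alpha>"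
      unfolding dc_competitive_def by blast
    have "size B = h" and Bp: "set_mset B \<subseteq> points T"
      using B by (auto simp: configs_def)
    obtain xs where xs: "mset xs = B"
      using ex_mset by blast
    define X\<^sub>0 where "X\<^sub>0 = (!) xs"
    have X0: "image_mset X\<^sub>0 (mset_set {..<size B}) = B"
      unfolding xs [symmetric] X\<^sub>0_def size_mset
      by (metis atLeast_upt map_nth mset_map mset_upt atLeast0LessThan)
    have X0p: "\<forall>i<h. X\<^sub>0 i \<in> points T"
      using xs Bp \<open>size B = h\<close> by (auto simp: X\<^sub>0_def)
    \<comment> \<open>A negative \<open>R\<close> would reverse the upper bound on the optimum when
      multiplied with it.\<close>
    define R' where "R' = max R 0"
    \<comment> \<open>The guaranteed surplus of one phase: online cost
      \<open>h * h * \<sigma> / 2\<close> minus \<open>R'\<close> times the offline cost, where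
      \<open>2 * (\<sigma> + 1) \<le> 4 * \<sigma>\<close>. It is positive iff
      \<open>R' < h / 8\<close>, the origin of the constant.\<close>
    have "0 < h * \<sigma> * (h / 2 - 4 * R')"
      using R hk \<sigma> by (auto simp: R'_def)
    then obtain N where N: "\<alpha> < real N * (h * \<sigma> * (h / 2 - 4 * R'))"
      using reals_Archimedean3 by blast
    have "set_mset A \<subseteq> points T" "A \<noteq> {#}" "size A < Suc k"
      using A hk by (auto simp: configs_def)
    with phases [of \<sigma> h A "Suc k" N] \<sigma> hk obtain I and c :: real where I: "set I \<subseteq> leaf_points T"
      "dc_run T A I c" "N * ((real h)\<^sup>2 * \<sigma> / 2) \<le> c"
      "affordable T h X\<^sub>0 I (real N * (h * (2 * (\<sigma> + 1))))"
      using X0p unfolding T_def by auto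
    have opt: "0 \<le> opt_cost T B I" "opt_cost T B I \<le> real N * (h * (2 * (\<sigma> + 1)))"
      using opt_cost_bounds [of T B X\<^sub>0 I] I(4) X0 \<open>size B = h\<close> by auto
    have "real N * (h * (2 * (\<sigma> + 1))) \<le> real N * (h * (4 * \<sigma>))"
      using \<sigma> by (intro mult_left_mono) auto
    then have "R' * opt_cost T B I \<le> R' * (real N * (h * (4 * \<sigma>)))"
      using opt by (intro mult_left_mono) (auto simp: R'_def)
    moreover have "R * opt_cost T B I \<le> R' * opt_cost T B I"
      using opt by (intro mult_right_mono) (auto simp: R'_def)
    ultimately have "N * ((real h)\<^sup>2 * \<sigma> / 2) \<le> R' * (real N * (h * (4 * \<sigma>))) + \<alpha>"
      using \<alpha> [OF I(1,2)] I(3) by linarith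
    then show False
      using N by (simp add: power2_eq_square algebra_simps)
  qed
  moreover have "depth_hst \<sigma> 2 T"
    unfolding T_def using \<sigma> hk by (intro depth_hst_broom) auto
  ultimately show "\<exists>T. depth_hst \<sigma> 2 T \<and> (\<forall>A\<in>configs T k. \<forall>B\<in>configs T h. \<forall>R::real.
      R < 1 / 8 * real h \<longrightarrow> \<not> dc_competitive T A B R)"
    by blast
qed

end
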